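(* Let $S\subset\mathcal H$ be a nonempty super-discrete set of sites in general position, and let $\mathbf S\subset\boldsymbol{\mathcal H}$ be a set such that $\mathrm{val}^*$ (applied coordinatewise) restricts to a bijection $\mathbf S\to -S$. Then for every $\mathbf a\in\mathbf S$, with $a=-\mathrm{val}^*(\mathbf a)\in S$, the map $\mathrm{val}^*$ (applied coordinatewise to points with positive coordinates and read in $\mathbb R^n/\mathbb R\mathbf 1\cong\mathcal H$) maps the farthest power region $\mathrm{PR}_{\mathbf S}(\mathbf a)$ onto the Voronoi region $\mathrm{VR}_S(a)$, and this induces a poset isomorphism from the farthest power diagram $\mathrm{PD}(\mathbf S)$ to the asymmetric tropical Voronoi diagram $\mathrm{VD}(S)$.
   Context: Let $n\ge2$, $\mathcal H=\{x\in\mathbb R^n:\sum_i x_i=0\}\cong\mathbb R^n/\mathbb R\mathbf 1$, and $d_\triangle(a,b)=\sum_i(b_i-a_i)+n\max_i(a_i-b_i)$. For a nonempty discrete $S\subset\mathcal H$ and $a\in S$, $\mathrm{VR}_S(a)=\{x\in\mathcal H:d_\triangle(x,a)\le d_\triangle(x,b)\ \forall b\in S\}$; $\mathrm{VD}(S)$ is the poset under inclusion of all intersections of nonempty families of Voronoi regions. $S$ is in general position if for all distinct $a,b\in S$ we have $a_i\ne b_i$ for all $i\in[n]$; $S$ is super-discrete if each coordinate projection $\{s_i:s\in S\}$ is discrete in $\mathbb R$. Let $\mathbb K$ be the field of generalized dual Puiseux series: formal series $\sum_{k\ge0}\alpha_k t^{r_k}$ with real coefficients and real exponents forming a strictly decreasing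 sequence without finite accumulation point; it is a real closed ordered field, the sign of a nonzero series being that of its leading coefficient $\alpha_0\neq0$, and $\mathrm{val}^*(\sum\alpha_kt^{r_k})=r_0$ (highest exponent). Let $\boldsymbol{\mathcal H}=\{\mathbf x\in\mathbb K_{>0}^n:\mathbf x_1\cdots\mathbf x_n=1\}$ and $\|\mathbf x\|^2=\sum_i\mathbf x_i^2$. For a set $\mathbf S\subset\mathbb K^n$ and $\mathbf a\in\mathbf S$ the farthest power region (with weight $\|\cdot\|^2$) is $\mathrm{PR}_{\mathbf S}(\mathbf a)=\{\mathbf x\in\mathbb K_{\ge0}^n:\|\mathbf x-\mathbf a\|^2-\|\mathbf a\|^2\ge\|\mathbf x-\mathbf b\|^2-\|\mathbf b\|^2\ \forall\mathbf b\in\mathbf S\}$, and the farthest power diagram $\mathrm{PD}(\mathbf S)$ is the poset under inclusion of all intersections of nonempty families of farthest power regions. *)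

theory Defs
  imports "HOL-Analysis.Analysis"
begin

section \<open>Generalized dual Puiseux series\<close>

text \<open>
  A series is represented by its coefficient function. Only finitely many exponents lie above any
  given bound; by \<open>dual_puiseux_support_iff\<close> below this says exactly that the exponents belong to
  a strictly decreasing sequence without finite accumulation point.
\<close>

typedef dual_puiseux = "{f :: real \<Rightarrow> real. \<forall>c. finite {r. c \<le> r \<and> f r \<noteq> 0}}"
  morphisms dp_coeff Abs_dual_puiseux
  by (rule exI[of _ "\<lambda>_. 0"]) simp

setup_lifting type_definition_dual_puiseux

lemma dual_puiseux_support_iff:
  fixes f :: "real \<Rightarrow> real"
  shows "(\<forall>c. finite {r. c \<le> r \<and> f r \<noteq> 0}) \<longleftrightarrow>
    (\<exists>e :: nat \<Rightarrow> real. (\<forall>k. e (Suc k) < e k) \<and> (\<forall>l. \<not> l islimpt range e) \<and> {r. f r \<noteq> 0} \<subseteq> range e)"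
    (is "?L \<longleftrightarrow> ?R")
proof
  assume L: ?L
  define T where "T = {r. f r \<noteq> 0} \<union> range (\<lambda>k::nat. - real k)"
  have fT: "finite {r \<in> T. c \<le> r}" for c
  proof -
    have "{r \<in> T. c \<le> r} \<subseteq> {r. c \<le> r \<and> f r \<noteq> 0} \<union> (\<lambda>k. - real k) ` {..nat \<lceil>-c\<rceil>}"
    proof
      fix r assume r: "r \<in> {r \<in> T. c \<le> r}"
      show "r \<in> {r. c \<le> r \<and> f r \<noteq> 0} \<union> (\<lambda>k. - real k) ` {..nat \<lceil>-c\<rceil>}"
      proof (cases "f r = 0")
        case True
        then obtain k :: nat where k: "r = - real k" using r by (auto simp: T_def)
        then have "k \<le> nat \<lceil>-c\<rceil>" using r by simp linarith
        then show ?thesis using k by auto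
      qed (use r in auto)
    qed
    moreover have "finite ({r. c \<le> r \<and> f r \<noteq> 0} \<union> (\<lambda>k. - real k) ` {..nat \<lceil>-c\<rceil>})"
      using L by simp
    ultimately show ?thesis by (rule finite_subset)
  qed
  have low: "\<exists>r\<in>T. r < c" for c
  proof -
    obtain k :: nat where "- c < real k" using reals_Archimedean2 by blast
    then show ?thesis by (intro bexI[of _ "- real k"]) (auto simp: T_def)
  qed
  have "\<exists>x. x \<in> T \<and> x < c \<and> (\<forall>r\<in>T. r < c \<longrightarrow> r \<le> x)" for c
  proof -
    obtain r0 where r0: "r0 \<in> T" "r0 < c" using low by blast
    let ?A = "{r \<in> T. r0 \<le> r \<and> r < c}"
    have fA: "finite ?A" by (rule finite_subset[OF _ fT[of r0]]) auto
    have "?A \<noteq> {}" using r0 by auto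
    then have m: "Max ?A \<in> ?A" using fA by (intro Max_in)
    have "r \<le> Max ?A" if "r \<in> T" "r < c" for r
    proof (cases "r0 \<le> r")
      case True
      then show ?thesis using that fA by (intro Max_ge) auto
    next
      case False
      then show ?thesis using m by auto
    qed
    then show ?thesis using m by blast
  qed
  then obtain nx where nx: "\<And>c. nx c \<in> T" "\<And>c. nx c < c" "\<And>c r. r \<in> T \<Longrightarrow> r < c \<Longrightarrow> r \<le> nx c"
    by metis
  define M where "M = Max {r \<in> T. 0 \<le> r}"
  have "0 \<in> T" by (auto simp: T_def intro: image_eqI[of _ _ 0])
  then have M: "M \<in> T" "0 \<le> M" using Max_in[OF fT[of 0]] by (auto simp: M_def)
  have M_ub: "r \<le> M" if "r \<in> T" for r
  proof (cases "0 \<le> r")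
    case True
    then show ?thesis using that fT[of 0] by (auto simp: M_def intro: Max_ge)
  qed (use M in auto)
  define e where "e = rec_nat M (\<lambda>_. nx)"
  have e0: "e 0 = M" and eS: "e (Suc k) = nx (e k)" for k by (auto simp: e_def)
  have dec: "e (Suc k) < e k" for k using nx eS by simp
  have eT: "e k \<in> T" for k by (cases k) (auto simp: e0 eS M nx)
  have "inj e"
  proof -
    have "strict_mono (\<lambda>k. - e k)" by (rule strict_monoI_Suc) (use dec in simp)
    then have "inj (\<lambda>k. - e k)" by (rule strict_mono_imp_inj_on)
    then show ?thesis by (simp add: inj_def)
  qed
  then have inf: "infinite (range e)" by (simp add: range_inj_infinite)
  have "T \<subseteq> range e"
  proof (rule ccontr)
    assume "\<not> T \<subseteq> range e"
    then obtain r where r: "r \<in> T" "r \<notin> range e" by blast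
    have lt: "r < e k" for k
    proof (induction k)
      case 0
      then show ?case using M_ub[of r] r e0 by (metis order_le_less rangeI)
    next
      case (Suc k)
      then show ?case using nx(3)[of r "e k"] r eS by (metis order_le_less rangeI)
    qed
    then have "range e \<subseteq> {x \<in> T. r \<le> x}" using eT by (auto intro: less_imp_le)
    then show False using inf fT[of r] finite_subset by blast
  qed
  moreover have "\<not> l islimpt range e" for l
  proof
    assume "l islimpt range e"
    then have "infinite (range e \<inter> ball l 1)" by (simp add: islimpt_eq_infinite_ball)
    moreover have "range e \<inter> ball l 1 \<subseteq> {x \<in> T. l - 1 \<le> x}"
      using eT by (auto simp: dist_real_def)
    ultimately show False using fT[of "l - 1"] finite_subset by blast
  qed
  ultimately show ?R using dec by (intro exI[of _ e]) (auto simp: T_def)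
next
  assume ?R
  then obtain e :: "nat \<Rightarrow> real" where e: "\<And>k. e (Suc k) < e k" "\<And>l. \<not> l islimpt range e"
    "{r. f r \<noteq> 0} \<subseteq> range e" by blast
  have le0: "e k \<le> e 0" for k by (induction k) (use e(1) less_imp_le order_trans in blast)+
  show ?L
  proof (rule allI, rule ccontr)
    fix c assume inf: "infinite {r. c \<le> r \<and> f r \<noteq> 0}"
    have "{r. c \<le> r \<and> f r \<noteq> 0} \<subseteq> {c..e 0}" using e(3) le0 by auto
    then obtain l where "l islimpt {r. c \<le> r \<and> f r \<noteq> 0}"
      using inf compact_Icc[of c "e 0"] by (metis compact_eq_Bolzano_Weierstrass)
    then have "l islimpt range e" by (rule islimpt_subset) (use e(3) in auto)
    then show False using e(2) by blast
  qed
qed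

lemma dp_coeff_finite: "finite {r. c \<le> r \<and> dp_coeff x r \<noteq> 0}"
  using dp_coeff[of x] by simp

lemma dp_eqI: "(\<And>r. dp_coeff x r = dp_coeff y r) \<Longrightarrow> x = y"
  by (metis dp_coeff_inject ext)

lemma dp_bounded: "\<exists>B. \<forall>r. dp_coeff x r \<noteq> 0 \<longrightarrow> r \<le> B"
proof -
  let ?A = "insert 0 {r. 0 \<le> r \<and> dp_coeff x r \<noteq> 0}"
  have "finite ?A" using dp_coeff_finite by simp
  then have "r \<le> Max ?A" if "dp_coeff x r \<noteq> 0" for r
    using that by (cases "0 \<le> r") (auto intro: Max_ge order_trans[of r 0])
  then show ?thesis by blast
qed

instantiation dual_puiseux :: ab_group_add
begin

lift_definition zero_dual_puiseux :: dual_puiseux is "\<lambda>_. 0" by simp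

lift_definition plus_dual_puiseux :: "dual_puiseux \<Rightarrow> dual_puiseux \<Rightarrow> dual_puiseux"
  is "\<lambda>f g r. f r + g r"
proof -
  fix f g :: "real \<Rightarrow> real"
  assume fg: "\<And>c. finite {r. c \<le> r \<and> f r \<noteq> 0}" "\<And>c. finite {r. c \<le> r \<and> g r \<noteq> 0}"
  show "finite {r. c \<le> r \<and> f r + g r \<noteq> 0}" for c
    by (rule finite_subset[of _ "{r. c \<le> r \<and> f r \<noteq> 0} \<union> {r. c \<le> r \<and> g r \<noteq> 0}"])
      (use fg in auto)
qed

lift_definition uminus_dual_puiseux :: "dual_puiseux \<Rightarrow> dual_puiseux"
  is "\<lambda>f r. - f r" by simp

definition minus_dual_puiseux :: "dual_puiseux \<Rightarrow> dual_puiseux \<Rightarrow> dual_puiseux"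
  where "x - y = x + - (y :: dual_puiseux)"

instance
  by standard (unfold minus_dual_puiseux_def, (transfer, simp add: algebra_simps)+)

end

lemma dp_coeff_0 [simp]: "dp_coeff 0 r = 0"
  by (simp add: zero_dual_puiseux.rep_eq)

lemma dp_coeff_add [simp]: "dp_coeff (x + y) r = dp_coeff x r + dp_coeff y r"
  by (simp add: plus_dual_puiseux.rep_eq)

lemma dp_coeff_uminus [simp]: "dp_coeff (- x) r = - dp_coeff x r"
  by (simp add: uminus_dual_puiseux.rep_eq)

lemma dp_coeff_diff [simp]: "dp_coeff (x - y) r = dp_coeff x r - dp_coeff y r"
  unfolding minus_dual_puiseux_def by (simp del: add_uminus_conv_diff)

lift_definition dp_monom :: "real \<Rightarrow> real \<Rightarrow> dual_puiseux" is "\<lambda>a e r. if r = e then a else 0"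
  by simp

lemma dp_coeff_monom: "dp_coeff (dp_monom a e) r = (if r = e then a else 0)"
  by (simp add: dp_monom.rep_eq)

lemma dp_conv_finite: "finite {p. dp_coeff x p \<noteq> 0 \<and> dp_coeff y (r - p) \<noteq> 0}"
proof -
  obtain B where B: "\<And>r. dp_coeff y r \<noteq> 0 \<Longrightarrow> r \<le> B" using dp_bounded by blast
  have "{p. dp_coeff x p \<noteq> 0 \<and> dp_coeff y (r - p) \<noteq> 0} \<subseteq> {p. r - B \<le> p \<and> dp_coeff x p \<noteq> 0}"
  proof (intro subsetI CollectI conjI; elim CollectE conjE)
    fix p assume "dp_coeff y (r - p) \<noteq> 0"
    then show "r - B \<le> p" using B[of "r - p"] by linarith
  qed
  then show ?thesis using dp_coeff_finite by (rule finite_subset)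
qed

instantiation dual_puiseux :: "{one, times}"
begin

definition one_dual_puiseux :: dual_puiseux where "1 = dp_monom 1 0"

lift_definition times_dual_puiseux :: "dual_puiseux \<Rightarrow> dual_puiseux \<Rightarrow> dual_puiseux"
  is "\<lambda>f g r. \<Sum>p | f p \<noteq> 0 \<and> g (r - p) \<noteq> 0. f p * g (r - p)"
proof -
  fix f g :: "real \<Rightarrow> real"
  assume fg: "\<And>c. finite {r. c \<le> r \<and> f r \<noteq> 0}" "\<And>c. finite {r. c \<le> r \<and> g r \<noteq> 0}"
  have "dp_coeff (Abs_dual_puiseux f) = f" using fg by (intro Abs_dual_puiseux_inverse) simp
  then obtain A where A: "\<And>r. f r \<noteq> 0 \<Longrightarrow> r \<le> A"
    using dp_bounded[of "Abs_dual_puiseux f"] by metis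
  have "dp_coeff (Abs_dual_puiseux g) = g" using fg by (intro Abs_dual_puiseux_inverse) simp
  then obtain B where B: "\<And>r. g r \<noteq> 0 \<Longrightarrow> r \<le> B"
    using dp_bounded[of "Abs_dual_puiseux g"] by metis
  show "finite {r. c \<le> r \<and> (\<Sum>p | f p \<noteq> 0 \<and> g (r - p) \<noteq> 0. f p * g (r - p)) \<noteq> 0}" for c
  proof -
    let ?P = "{p. c - B \<le> p \<and> f p \<noteq> 0}" and ?Q = "{p. c - A \<le> p \<and> g p \<noteq> 0}"
    have "{r. c \<le> r \<and> (\<Sum>p | f p \<noteq> 0 \<and> g (r - p) \<noteq> 0. f p * g (r - p)) \<noteq> 0}
      \<subseteq> (\<lambda>(p, q). p + q) ` (?P \<times> ?Q)"
    proof
      fix r assume r: "r \<in> {r. c \<le> r \<and> (\<Sum>p | f p \<noteq> 0 \<and> g (r - p) \<noteq> 0. f p * g (r - p)) \<noteq> 0}"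
      then have "(\<Sum>p | f p \<noteq> 0 \<and> g (r - p) \<noteq> 0. f p * g (r - p)) \<noteq> 0" by simp
      then obtain p where p: "f p \<noteq> 0" "g (r - p) \<noteq> 0"
        by (rule sum.not_neutral_contains_not_neutral) auto
      then have "c - B \<le> p" "c - A \<le> r - p" using A[of p] B[of "r - p"] r by auto
      then have "(p, r - p) \<in> ?P \<times> ?Q" using p by simp
      then show "r \<in> (\<lambda>(p, q). p + q) ` (?P \<times> ?Q)" by (rule rev_image_eqI) simp
    qed
    moreover have "finite ((\<lambda>(p, q). p + q) ` (?P \<times> ?Q))" using fg by (intro finite_imageI finite_cartesian_product)
    ultimately show "finite {r. c \<le> r \<and> (\<Sum>p | f p \<noteq> 0 \<and> g (r - p) \<noteq> 0. f p * g (r - p)) \<noteq> 0}"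
      by (rule finite_subset)
  qed
qed

instance ..

end

lemma dp_coeff_1: "dp_coeff 1 r = (if r = 0 then 1 else 0)"
  by (simp add: one_dual_puiseux_def dp_coeff_monom)

lemma dp_coeff_mult:
  assumes "finite P" "{p. dp_coeff x p \<noteq> 0 \<and> dp_coeff y (r - p) \<noteq> 0} \<subseteq> P"
  shows "dp_coeff (x * y) r = (\<Sum>p\<in>P. dp_coeff x p * dp_coeff y (r - p))"
proof -
  have "dp_coeff (x * y) r =
      (\<Sum>p | dp_coeff x p \<noteq> 0 \<and> dp_coeff y (r - p) \<noteq> 0. dp_coeff x p * dp_coeff y (r - p))"
    by (simp add: times_dual_puiseux.rep_eq)
  also have "\<dots> = (\<Sum>p\<in>P. dp_coeff x p * dp_coeff y (r - p))"
    by (rule sum.mono_neutral_left) (use assms in auto)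
  finally show ?thesis .
qed

lemma dp_mult_nonzeroE:
  assumes "dp_coeff (x * y) r \<noteq> 0"
  obtains p where "dp_coeff x p \<noteq> 0" "dp_coeff y (r - p) \<noteq> 0"
proof -
  have "dp_coeff (x * y) r =
      (\<Sum>p | dp_coeff x p \<noteq> 0 \<and> dp_coeff y (r - p) \<noteq> 0. dp_coeff x p * dp_coeff y (r - p))"
    by (rule dp_coeff_mult[OF dp_conv_finite]) simp
  then have "(\<Sum>p | dp_coeff x p \<noteq> 0 \<and> dp_coeff y (r - p) \<noteq> 0.
      dp_coeff x p * dp_coeff y (r - p)) \<noteq> 0" using assms by simp
  then show thesis by (rule sum.not_neutral_contains_not_neutral) (use that in auto)
qed

lemma dp_mult_commute: "x * y = y * (x :: dual_puiseux)"
proof (rule dp_eqI)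
  fix r
  let ?A = "\<lambda>x y. {p. dp_coeff x p \<noteq> 0 \<and> dp_coeff y (r - p) \<noteq> 0}"
  have "dp_coeff (x * y) r = (\<Sum>p\<in>?A x y. dp_coeff x p * dp_coeff y (r - p))"
    by (rule dp_coeff_mult[OF dp_conv_finite]) simp
  also have "\<dots> = (\<Sum>p\<in>?A y x. dp_coeff y p * dp_coeff x (r - p))"
    by (rule sum.reindex_bij_witness[of _ "\<lambda>p. r - p" "\<lambda>p. r - p"]) auto
  also have "\<dots> = dp_coeff (y * x) r"
    by (rule dp_coeff_mult[OF dp_conv_finite, symmetric]) simp
  finally show "dp_coeff (x * y) r = dp_coeff (y * x) r" .
qed

lemma dp_mult_assoc: "(x * y) * z = x * (y * z :: dual_puiseux)"
proof (rule dp_eqI)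
  fix r
  obtain X where X: "\<And>r. dp_coeff x r \<noteq> 0 \<Longrightarrow> r \<le> X" using dp_bounded by blast
  obtain Y where Y: "\<And>r. dp_coeff y r \<noteq> 0 \<Longrightarrow> r \<le> Y" using dp_bounded by blast
  obtain Z where Z: "\<And>r. dp_coeff z r \<noteq> 0 \<Longrightarrow> r \<le> Z" using dp_bounded by blast
  have XY: "u \<le> X + Y" if "dp_coeff (x * y) u \<noteq> 0" for u
    using that by (rule dp_mult_nonzeroE) (use X Y in force)
  have YZ: "u \<le> Y + Z" if "dp_coeff (y * z) u \<noteq> 0" for u
    using that by (rule dp_mult_nonzeroE) (use Y Z in force)
  define P where "P = {p. r - Y - Z \<le> p \<and> dp_coeff x p \<noteq> 0}"
  define Q where "Q = {q. r - X - Y \<le> q \<and> dp_coeff z q \<noteq> 0}"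
  have fin: "finite P" "finite Q" by (simp_all add: P_def Q_def dp_coeff_finite)
  have "dp_coeff ((x * y) * z) r = dp_coeff (z * (x * y)) r" by (simp add: dp_mult_commute)
  also have "\<dots> = (\<Sum>q\<in>Q. dp_coeff z q * dp_coeff (x * y) (r - q))"
    by (rule dp_coeff_mult) (use fin XY in \<open>force simp: Q_def\<close>)+
  also have "\<dots> = (\<Sum>q\<in>Q. dp_coeff z q * (\<Sum>p\<in>P. dp_coeff x p * dp_coeff y (r - q - p)))"
  proof (rule sum.cong[OF refl])
    fix q assume "q \<in> Q"
    then have "q \<le> Z" using Z by (simp add: Q_def)
    then have "{p. dp_coeff x p \<noteq> 0 \<and> dp_coeff y (r - q - p) \<noteq> 0} \<subseteq> P"
      using Y by (force simp: P_def)
    then show "dp_coeff z q * dp_coeff (x * y) (r - q) =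
        dp_coeff z q * (\<Sum>p\<in>P. dp_coeff x p * dp_coeff y (r - q - p))"
      using dp_coeff_mult[OF fin(1)] by simp
  qed
  also have "\<dots> = (\<Sum>p\<in>P. \<Sum>q\<in>Q. dp_coeff x p * (dp_coeff z q * dp_coeff y (r - p - q)))"
    unfolding sum_distrib_left by (subst sum.swap) (simp add: algebra_simps)
  also have "\<dots> = (\<Sum>p\<in>P. dp_coeff x p * dp_coeff (z * y) (r - p))"
  proof (rule sum.cong[OF refl])
    fix p assume "p \<in> P"
    then have "p \<le> X" using X by (simp add: P_def)
    then have "{q. dp_coeff z q \<noteq> 0 \<and> dp_coeff y (r - p - q) \<noteq> 0} \<subseteq> Q"
      using Y by (force simp: Q_def)
    then show "(\<Sum>q\<in>Q. dp_coeff x p * (dp_coeff z q * dp_coeff y (r - p - q))) =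
        dp_coeff x p * dp_coeff (z * y) (r - p)"
      using dp_coeff_mult[OF fin(2)] by (simp add: sum_distrib_left)
  qed
  also have "\<dots> = dp_coeff (x * (z * y)) r"
    by (rule dp_coeff_mult[symmetric]) (use fin YZ in \<open>force simp: P_def dp_mult_commute[of z y]\<close>)+
  finally show "dp_coeff ((x * y) * z) r = dp_coeff (x * (y * z)) r"
    by (simp add: dp_mult_commute)
qed

lemma dp_mult_distrib: "(x + y) * z = x * z + y * (z :: dual_puiseux)"
proof (rule dp_eqI)
  fix r
  let ?P = "{p. dp_coeff x p \<noteq> 0 \<and> dp_coeff z (r - p) \<noteq> 0} \<union>
    {p. dp_coeff y p \<noteq> 0 \<and> dp_coeff z (r - p) \<noteq> 0}"
  have fin: "finite ?P" using dp_conv_finite by simp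
  have "dp_coeff ((x + y) * z) r = (\<Sum>p\<in>?P. dp_coeff (x + y) p * dp_coeff z (r - p))"
    by (rule dp_coeff_mult[OF fin]) auto
  moreover have "dp_coeff (x * z) r = (\<Sum>p\<in>?P. dp_coeff x p * dp_coeff z (r - p))"
    by (rule dp_coeff_mult[OF fin]) auto
  moreover have "dp_coeff (y * z) r = (\<Sum>p\<in>?P. dp_coeff y p * dp_coeff z (r - p))"
    by (rule dp_coeff_mult[OF fin]) auto
  ultimately show "dp_coeff ((x + y) * z) r = dp_coeff (x * z + y * z) r"
    by (simp add: algebra_simps sum.distrib)
qed

lemma dp_coeff_monom_mult: "dp_coeff (dp_monom a e * x) r = a * dp_coeff x (r - e)"
  by (subst dp_coeff_mult[of "{e}"]) (auto simp: dp_coeff_monom)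

instance dual_puiseux :: comm_ring_1
proof
  fix a b c :: dual_puiseux
  show "a * b * c = a * (b * c)" by (rule dp_mult_assoc)
  show "a * b = b * a" by (rule dp_mult_commute)
  show "1 * a = a" by (rule dp_eqI) (simp add: one_dual_puiseux_def dp_coeff_monom_mult)
  show "(a + b) * c = a * c + b * c" by (rule dp_mult_distrib)
  show "(0 :: dual_puiseux) \<noteq> 1" by (metis dp_coeff_0 dp_coeff_1 zero_neq_one)
qed

subsection \<open>Valuation and order\<close>

text \<open>The value at the zero series is irrelevant.\<close>

definition dp_val :: "dual_puiseux \<Rightarrow> real"
  where "dp_val x = (GREATEST r. dp_coeff x r \<noteq> 0)"

definition dp_lead_coeff :: "dual_puiseux \<Rightarrow> real"
  where "dp_lead_coeff x = dp_coeff x (dp_val x)"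

lemma dp_val_props:
  assumes "x \<noteq> 0"
  shows dp_lead_coeff_nonzero: "dp_lead_coeff x \<noteq> 0"
    and dp_val_ge: "dp_coeff x r \<noteq> 0 \<Longrightarrow> r \<le> dp_val x"
proof -
  obtain c where c: "dp_coeff x c \<noteq> 0" using assms dp_eqI[of x 0] by auto
  let ?A = "{r. c \<le> r \<and> dp_coeff x r \<noteq> 0}"
  have fin: "finite ?A" by (rule dp_coeff_finite)
  have M: "Max ?A \<in> ?A" using fin c by (intro Max_in) auto
  have ub: "r \<le> Max ?A" if "dp_coeff x r \<noteq> 0" for r
    using that fin M by (cases "c \<le> r") (auto intro: Max_ge)
  have "dp_val x = Max ?A"
    unfolding dp_val_def by (rule Greatest_equality) (use M ub in auto)
  then show "dp_lead_coeff x \<noteq> 0" "dp_coeff x r \<noteq> 0 \<Longrightarrow> r \<le> dp_val x"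
    using M ub by (auto simp: dp_lead_coeff_def)
qed

lemma dp_val_eqI:
  assumes "dp_coeff x v \<noteq> 0" "\<And>r. v < r \<Longrightarrow> dp_coeff x r = 0"
  shows "dp_val x = v"
  unfolding dp_val_def by (rule Greatest_equality) (use assms in \<open>auto simp: not_less[symmetric]\<close>)

lemma dp_val_mult_coeff:
  assumes "x \<noteq> 0" "y \<noteq> 0"
  shows "dp_coeff (x * y) (dp_val x + dp_val y) = dp_lead_coeff x * dp_lead_coeff y"
    and "dp_val x + dp_val y < r \<Longrightarrow> dp_coeff (x * y) r = 0"
proof -
  show "dp_coeff (x * y) (dp_val x + dp_val y) = dp_lead_coeff x * dp_lead_coeff y"
    by (subst dp_coeff_mult[of "{dp_val x}"])
      (use dp_val_ge[OF assms(1)] dp_val_ge[OF assms(2)] in \<open>force simp: dp_lead_coeff_def\<close>)+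
  show "dp_coeff (x * y) r = 0" if "dp_val x + dp_val y < r"
  proof (rule ccontr)
    assume "dp_coeff (x * y) r \<noteq> 0"
    then show False
      by (rule dp_mult_nonzeroE) (use that dp_val_ge[OF assms(1)] dp_val_ge[OF assms(2)] in force)
  qed
qed

lemma dp_val_mult:
  assumes "x \<noteq> 0" "y \<noteq> 0"
  shows "x * y \<noteq> 0" "dp_val (x * y) = dp_val x + dp_val y"
    "dp_lead_coeff (x * y) = dp_lead_coeff x * dp_lead_coeff y"
proof -
  have nz: "dp_coeff (x * y) (dp_val x + dp_val y) \<noteq> 0"
    using dp_val_mult_coeff(1)[OF assms] dp_lead_coeff_nonzero[OF assms(1)]
      dp_lead_coeff_nonzero[OF assms(2)] by simp
  then show "x * y \<noteq> 0" by auto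
  show v: "dp_val (x * y) = dp_val x + dp_val y"
    by (rule dp_val_eqI[OF nz]) (rule dp_val_mult_coeff(2)[OF assms])
  show "dp_lead_coeff (x * y) = dp_lead_coeff x * dp_lead_coeff y"
    using dp_val_mult_coeff(1)[OF assms] v by (simp add: dp_lead_coeff_def)
qed

definition dp_pos :: "dual_puiseux \<Rightarrow> bool"
  where "dp_pos x \<longleftrightarrow> x \<noteq> 0 \<and> 0 < dp_lead_coeff x"

lemma dp_val_uminus [simp]: "dp_val (- x) = dp_val x"
  by (simp add: dp_val_def)

lemma dp_lead_coeff_uminus [simp]: "dp_lead_coeff (- x) = - dp_lead_coeff x"
  by (simp add: dp_lead_coeff_def)

lemma dp_pos_cases: "x = 0 \<or> dp_pos x \<or> dp_pos (- x)"
  using dp_lead_coeff_nonzero[of x] by (auto simp: dp_pos_def)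

lemma dp_pos_uminus: "dp_pos x \<Longrightarrow> \<not> dp_pos (- x)"
  by (auto simp: dp_pos_def)

lemma dp_pos_mult: "dp_pos x \<Longrightarrow> dp_pos y \<Longrightarrow> dp_pos (x * y)"
  by (simp add: dp_pos_def dp_val_mult)

lemma dp_pos_add:
  assumes "dp_pos x" "dp_pos y"
  shows "dp_pos (x + y)"
proof -
  have x: "x \<noteq> 0" "0 < dp_coeff x (dp_val x)" and y: "y \<noteq> 0" "0 < dp_coeff y (dp_val y)"
    using assms by (auto simp: dp_pos_def dp_lead_coeff_def)
  have x0: "dp_coeff x r = 0" if "dp_val x < r" for r using dp_val_ge[OF x(1), of r] that by force
  have y0: "dp_coeff y r = 0" if "dp_val y < r" for r using dp_val_ge[OF y(1), of r] that by force
  define v where "v = max (dp_val x) (dp_val y)"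
  have p: "0 < dp_coeff (x + y) v"
    using x y x0 y0 by (cases "dp_val x" "dp_val y" rule: linorder_cases) (auto simp: v_def max_def)
  have "dp_val (x + y) = v"
    by (rule dp_val_eqI) (use p x0 y0 in \<open>auto simp: v_def\<close>)
  then show ?thesis using p by (auto simp: dp_pos_def dp_lead_coeff_def simp del: dp_coeff_add)
qed

subsection \<open>Inverses\<close>

lemma dp_power_support:
  assumes "\<And>r. dp_coeff u r \<noteq> 0 \<Longrightarrow> r \<le> d" "dp_coeff (u ^ k) r \<noteq> 0"
  shows "r \<le> real k * d"
  using assms(2)
proof (induction k arbitrary: r)
  case 0
  then show ?case by (simp add: dp_coeff_1 split: if_splits)
next
  case (Suc k)
  from Suc.prems have "dp_coeff (u * u ^ k) r \<noteq> 0" by simp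
  then obtain p where "dp_coeff u p \<noteq> 0" "dp_coeff (u ^ k) (r - p) \<noteq> 0"
    by (rule dp_mult_nonzeroE)
  then have "p \<le> d" "r - p \<le> real k * d" using assms(1) Suc.IH by blast+
  then show ?case by (simp add: algebra_simps)
qed

lemma dp_geometric:
  assumes d: "d < 0" and u: "\<And>r. dp_coeff u r \<noteq> 0 \<Longrightarrow> r \<le> d"
  shows "\<exists>y. (1 - u) * y = 1"
proof -
  define N where "N c = nat \<lceil>c / d\<rceil>" for c
  have N: "dp_coeff (u ^ k) r = 0" if "N c < k" "c \<le> r" for k c r
  proof (rule ccontr)
    assume "dp_coeff (u ^ k) r \<noteq> 0"
    then have "c \<le> real k * d" using dp_power_support[OF u] that by force
    then have "real k \<le> c / d" using d by (simp add: field_simps)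
    moreover have "c / d < real k" using that(1) unfolding N_def by linarith
    ultimately show False by simp
  qed
  define G where "G r = (\<Sum>k\<le>N r. dp_coeff (u ^ k) r)" for r
  have G: "G r = (\<Sum>k\<le>m. dp_coeff (u ^ k) r)" if "N c \<le> m" "c \<le> r" for c m r
  proof -
    have "(\<Sum>k\<le>m. dp_coeff (u ^ k) r) = (\<Sum>k\<le>max m (N r). dp_coeff (u ^ k) r)"
      by (rule sum.mono_neutral_left) (use that N[of c _ r] in auto)
    moreover have "G r = (\<Sum>k\<le>max m (N r). dp_coeff (u ^ k) r)"
      unfolding G_def by (rule sum.mono_neutral_left) (use N[of r _ r] in auto)
    ultimately show ?thesis by simp
  qed
  have coeff_sum: "dp_coeff (\<Sum>k\<le>m. u ^ k) r = (\<Sum>k\<le>m. dp_coeff (u ^ k) r)" for m r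
    by (induction m) auto
  have "finite {r. c \<le> r \<and> G r \<noteq> 0}" for c
  proof (rule finite_subset)
    show "{r. c \<le> r \<and> G r \<noteq> 0} \<subseteq> {r. c \<le> r \<and> dp_coeff (\<Sum>k\<le>N c. u ^ k) r \<noteq> 0}"
      using G[of c "N c"] by (auto simp: coeff_sum)
  qed (rule dp_coeff_finite)
  then have y: "dp_coeff (Abs_dual_puiseux G) r = G r" for r
    by (simp add: Abs_dual_puiseux_inverse)
  define Y where "Y = Abs_dual_puiseux G"
  have "(1 - u) * Y = 1"
  proof (rule dp_eqI)
    fix r
    define m where "m = N r"
    define Ym where "Ym = (\<Sum>k\<le>m. u ^ k)"
    have Y_eq: "dp_coeff Y s = dp_coeff Ym s" if "r \<le> s" for s
      using G[of r m s] that by (simp add: Y_def y Ym_def coeff_sum m_def)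
    have "dp_coeff ((1 - u) * (Y - Ym)) r = 0"
    proof (rule ccontr)
      assume "dp_coeff ((1 - u) * (Y - Ym)) r \<noteq> 0"
      then obtain p where p: "dp_coeff (1 - u) p \<noteq> 0" "dp_coeff (Y - Ym) (r - p) \<noteq> 0"
        by (rule dp_mult_nonzeroE)
      have "p \<le> 0" using p(1) u[of p] d by (cases "p = 0") (auto simp: dp_coeff_1)
      then show False using p(2) Y_eq[of "r - p"] by simp
    qed
    then have "dp_coeff ((1 - u) * Y) r = dp_coeff ((1 - u) * Ym) r"
      by (simp add: right_diff_distrib)
    also have "(1 - u) * Ym = 1 - u ^ Suc m"
      unfolding Ym_def by (rule sum_gp_basic)
    also have "dp_coeff (1 - u ^ Suc m) r = dp_coeff 1 r"
      using N[of r "Suc m" r] by (simp add: m_def)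
    finally show "dp_coeff ((1 - u) * Y) r = dp_coeff 1 r" .
  qed
  then show ?thesis by blast
qed

lemma dp_inverse_ex:
  assumes "x \<noteq> 0"
  shows "\<exists>y :: dual_puiseux. x * y = 1"
proof -
  define v where "v = dp_val x"
  define a where "a = dp_lead_coeff x"
  have a: "a \<noteq> 0" "dp_coeff x v = a"
    using dp_lead_coeff_nonzero[OF assms] by (auto simp: a_def v_def dp_lead_coeff_def)
  define m where "m = dp_monom (1 / a) (- v)"
  define u where "u = 1 - m * x"
  have cu: "dp_coeff u r = (if r = 0 then 0 else - (1 / a * dp_coeff x (r + v)))" for r
    using a by (simp add: u_def m_def dp_coeff_monom_mult dp_coeff_1)
  have neg: "r < 0" if "dp_coeff u r \<noteq> 0" for r
    using that dp_val_ge[OF assms, of "r + v"] by (auto simp: cu v_def split: if_splits)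
  have "\<exists>d<0. \<forall>r. dp_coeff u r \<noteq> 0 \<longrightarrow> r \<le> d"
  proof (cases "u = 0")
    case True
    then show ?thesis by (intro exI[of _ "-1"]) simp
  next
    case False
    then show ?thesis using dp_val_ge[OF False] dp_lead_coeff_nonzero[OF False] neg
      by (intro exI[of _ "dp_val u"]) (auto simp: dp_lead_coeff_def)
  qed
  then obtain d where "d < 0" "\<And>r. dp_coeff u r \<noteq> 0 \<Longrightarrow> r \<le> d" by blast
  then obtain y where "(1 - u) * y = 1" using dp_geometric by blast
  then have "x * (m * y) = 1" by (simp add: u_def algebra_simps)
  then show ?thesis by blast
qed

instantiation dual_puiseux :: linordered_field
begin

definition less_dual_puiseux :: "dual_puiseux \<Rightarrow> dual_puiseux \<Rightarrow> bool"
  where "x < y \<longleftrightarrow> dp_pos (y - x)"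

definition less_eq_dual_puiseux :: "dual_puiseux \<Rightarrow> dual_puiseux \<Rightarrow> bool"
  where "x \<le> y \<longleftrightarrow> x = y \<or> dp_pos (y - x)"

definition abs_dual_puiseux :: "dual_puiseux \<Rightarrow> dual_puiseux"
  where "\<bar>x :: dual_puiseux\<bar> = (if x < 0 then - x else x)"

definition sgn_dual_puiseux :: "dual_puiseux \<Rightarrow> dual_puiseux"
  where "sgn (x :: dual_puiseux) = (if x = 0 then 0 else if 0 < x then 1 else - 1)"

definition inverse_dual_puiseux :: "dual_puiseux \<Rightarrow> dual_puiseux"
  where "inverse (x :: dual_puiseux) = (if x = 0 then 0 else (THE y. x * y = 1))"

definition divide_dual_puiseux :: "dual_puiseux \<Rightarrow> dual_puiseux \<Rightarrow> dual_puiseux"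
  where "x div y = x * inverse (y :: dual_puiseux)"

instance
proof
  fix x y z :: dual_puiseux
  have zero: "\<not> dp_pos 0" by (simp add: dp_pos_def)
  have anti: "\<not> (dp_pos (y - x) \<and> dp_pos (x - y))" for x y
    using dp_pos_uminus[of "y - x"] by auto
  show "(x < y) = (x \<le> y \<and> \<not> y \<le> x)"
    using anti zero by (auto simp: less_dual_puiseux_def less_eq_dual_puiseux_def)
  show "x \<le> x" by (simp add: less_eq_dual_puiseux_def)
  show "x \<le> z" if "x \<le> y" "y \<le> z"
    using that dp_pos_add[of "y - x" "z - y"] by (auto simp: less_eq_dual_puiseux_def)
  show "x = y" if "x \<le> y" "y \<le> x"
    using that anti by (auto simp: less_eq_dual_puiseux_def)
  show "x \<le> y \<or> y \<le> x"
    using dp_pos_cases[of "y - x"] by (auto simp: less_eq_dual_puiseux_def)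
  show "z + x \<le> z + y" if "x \<le> y"
    using that by (auto simp: less_eq_dual_puiseux_def)
  show "z * x < z * y" if "x < y" "0 < z"
    using that dp_pos_mult[of z "y - x"] by (simp add: less_dual_puiseux_def right_diff_distrib)
  show "\<bar>x\<bar> = (if x < 0 then - x else x)" by (rule abs_dual_puiseux_def)
  show "sgn x = (if x = 0 then 0 else if 0 < x then 1 else - 1)" by (rule sgn_dual_puiseux_def)
  show "inverse x * x = 1" if "x \<noteq> 0"
  proof -
    obtain y where y: "x * y = 1" using dp_inverse_ex[OF \<open>x \<noteq> 0\<close>] by blast
    have "z = y" if "x * z = 1" for z
      using y that by (metis mult.assoc mult.commute mult_1)
    then have "(THE y. x * y = 1) = y" using y by (intro the_equality)
    then show ?thesis using y that by (simp add: inverse_dual_puiseux_def mult.commute)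
  qed
  show "x div y = x * inverse y" by (rule divide_dual_puiseux_def)
  show "inverse (0 :: dual_puiseux) = 0" by (simp add: inverse_dual_puiseux_def)
qed

end

section \<open>Asymmetric tropical Voronoi diagrams\<close>

definition trop_H :: "(real ^ 'n) set"
  where "trop_H = {x. (\<Sum>i\<in>UNIV. x $ i) = 0}"

text \<open>The representative in \<open>trop_H\<close> of a class modulo the all-ones vector.\<close>

definition trop_proj :: "real ^ 'n \<Rightarrow> real ^ 'n"
  where "trop_proj x = (\<chi> i. x $ i - (\<Sum>j\<in>UNIV. x $ j) / real CARD('n))"

definition d_tri :: "real ^ 'n \<Rightarrow> real ^ 'n \<Rightarrow> real"
  where "d_tri a b = (\<Sum>i\<in>UNIV. b $ i - a $ i) + real CARD('n) * Max (range (\<lambda>i. a $ i - b $ i))"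

definition voronoi_region :: "(real ^ 'n) set \<Rightarrow> real ^ 'n \<Rightarrow> (real ^ 'n) set"
  where "voronoi_region S a = {x \<in> trop_H. \<forall>b\<in>S. d_tri x a \<le> d_tri x b}"

definition voronoi_diagram :: "(real ^ 'n) set \<Rightarrow> (real ^ 'n) set set"
  where "voronoi_diagram S = {\<Inter>a\<in>A. voronoi_region S a | A. A \<subseteq> S \<and> A \<noteq> {}}"

definition general_position :: "(real ^ 'n) set \<Rightarrow> bool"
  where "general_position S \<longleftrightarrow> (\<forall>a\<in>S. \<forall>b\<in>S. a \<noteq> b \<longrightarrow> (\<forall>i. a $ i \<noteq> b $ i))"

definition super_discrete :: "(real ^ 'n) set \<Rightarrow> bool"
  where "super_discrete S \<longleftrightarrow> (\<forall>i. discrete ((\<lambda>s. s $ i) ` S))"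

section \<open>Farthest power diagrams over the dual Puiseux series\<close>

definition dp_H :: "(dual_puiseux ^ 'n) set"
  where "dp_H = {x. (\<forall>i. 0 < x $ i) \<and> (\<Prod>i\<in>UNIV. x $ i) = 1}"

definition dp_sqnorm :: "dual_puiseux ^ 'n \<Rightarrow> dual_puiseux"
  where "dp_sqnorm x = (\<Sum>i\<in>UNIV. (x $ i)\<^sup>2)"

definition dp_vec_val :: "dual_puiseux ^ 'n \<Rightarrow> real ^ 'n"
  where "dp_vec_val x = (\<chi> i. dp_val (x $ i))"

definition power_region :: "(dual_puiseux ^ 'n) set \<Rightarrow> dual_puiseux ^ 'n \<Rightarrow> (dual_puiseux ^ 'n) set"
  where "power_region S a = {x. (\<forall>i. 0 \<le> x $ i) \<and>
    (\<forall>b\<in>S. dp_sqnorm (x - a) - dp_sqnorm a \<ge> dp_sqnorm (x - b) - dp_sqnorm b)}"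

definition power_diagram :: "(dual_puiseux ^ 'n) set \<Rightarrow> (dual_puiseux ^ 'n) set set"
  where "power_diagram S = {\<Inter>a\<in>A. power_region S a | A. A \<subseteq> S \<and> A \<noteq> {}}"

text \<open>Only points with positive coordinates have a finite valuation in every coordinate.\<close>

definition val_image :: "(dual_puiseux ^ 'n) set \<Rightarrow> (real ^ 'n) set"
  where "val_image F = (\<lambda>x. trop_proj (dp_vec_val x)) ` {x \<in> F. \<forall>i. 0 < x $ i}"

definition poset_iso :: "('a set \<Rightarrow> 'b set) \<Rightarrow> 'a set set \<Rightarrow> 'b set set \<Rightarrow> bool"
  where "poset_iso \<phi> P Q \<longleftrightarrow> bij_betw \<phi> P Q \<and> (\<forall>F\<in>P. \<forall>G\<in>P. F \<subseteq> G \<longleftrightarrow> \<phi> F \<subseteq> \<phi> G)"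

end

theory Submission
  imports Defs
begin

text \<open>
  Expanding the squares, a point \<open>x\<close> lies in the power region of \<open>a\<close> iff the site \<open>a\<close> minimises
  the scalar product of \<open>x\<close> with the sites. For positive \<open>x\<close> the valuation of this product is the
  maximum of the \<open>val x\<^sub>i + val a\<^sub>i\<close>, and on \<open>trop_H\<close> the distance \<open>d_tri\<close> to \<open>- val a\<close> is an
  increasing affine function of that maximum; so power regions are mapped into Voronoi regions. Conversely, let
  \<open>w\<close> lie in the Voronoi regions of a set \<open>A\<close> of sites. By general position the tied sites attain
  the maximum in disjoint sets of coordinates, so leading coefficients of a lift of \<open>w\<close> can be
  chosen independently for each of them, and equality of the scalar products on \<open>A\<close> is a linear
  system which is diagonal modulo infinitesimals. Raising \<open>w\<close> slightly in a coordinate where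
  a tied site outside \<open>A\<close> attains its maximum leaves the region of that site but not those of \<open>A\<close>;
  hence inclusion of nonempty Voronoi cells forces reverse inclusion of the site sets.
\<close>

section \<open>Leading terms of sums of positive series\<close>

lemma dp_gt_0_iff: "0 < x \<longleftrightarrow> x \<noteq> 0 \<and> 0 < dp_lead_coeff x" for x :: dual_puiseux
  by (simp add: less_dual_puiseux_def dp_pos_def)

lemma dp_coeff_above_val:
  assumes "dp_val x < r" shows "dp_coeff x r = 0"
proof (cases "x = 0")
  case False
  then show ?thesis using dp_val_ge[OF False, of r] assms by force
qed simp

lemma dp_coeff_sum: "dp_coeff (sum f I) r = (\<Sum>i\<in>I. dp_coeff (f i) r)"
  by (induction I rule: infinite_finite_induct) auto

lemma dp_posI:
  assumes "0 < dp_coeff x v" "\<And>r. v < r \<Longrightarrow> dp_coeff x r = 0"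
  shows "0 < x" "dp_val x = v" "dp_lead_coeff x = dp_coeff x v"
proof -
  show v: "dp_val x = v" by (rule dp_val_eqI) (use assms in auto)
  show "dp_lead_coeff x = dp_coeff x v" by (simp add: dp_lead_coeff_def v)
  then show "0 < x" using assms by (auto simp: dp_gt_0_iff)
qed

text \<open>Terms of valuation below \<open>m\<close> contribute nothing at \<open>m\<close>. The
  bound may fail to be attained, and the right-hand sum may be empty or cancel.\<close>

lemma dp_sum_leading:
  assumes "finite I" "\<And>i. i \<in> I \<Longrightarrow> dp_val (f i) \<le> m"
  shows "dp_coeff (sum f I) m = (\<Sum>i | i \<in> I \<and> dp_val (f i) = m. dp_lead_coeff (f i))"
    and "m < r \<Longrightarrow> dp_coeff (sum f I) r = 0"
proof -
  have "dp_coeff (f i) m = 0" if "i \<in> I" "dp_val (f i) \<noteq> m" for i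
    using that assms(2)[of i] by (intro dp_coeff_above_val) simp
  then have "(\<Sum>i\<in>I. dp_coeff (f i) m) = (\<Sum>i | i \<in> I \<and> dp_val (f i) = m. dp_coeff (f i) m)"
    using assms(1) by (intro sum.mono_neutral_right) auto
  also have "\<dots> = (\<Sum>i | i \<in> I \<and> dp_val (f i) = m. dp_lead_coeff (f i))"
    by (rule sum.cong) (auto simp: dp_lead_coeff_def)
  finally show "dp_coeff (sum f I) m = (\<Sum>i | i \<in> I \<and> dp_val (f i) = m. dp_lead_coeff (f i))"
    by (simp add: dp_coeff_sum)
  show "dp_coeff (sum f I) r = 0" if "m < r"
    unfolding dp_coeff_sum using that assms(2)
    by (intro sum.neutral ballI dp_coeff_above_val) fastforce
qed

text \<open>Positive leading coefficients cannot cancel, so the largest valuation among the terms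
  survives in the sum.\<close>

lemma dp_val_sum_pos:
  assumes "finite I" "I \<noteq> {}" "\<And>i. i \<in> I \<Longrightarrow> 0 < f i"
  shows "0 < sum f I" "dp_val (sum f I) = Max ((\<lambda>i. dp_val (f i)) ` I)"
proof -
  define m where "m = Max ((\<lambda>i. dp_val (f i)) ` I)"
  have le: "dp_val (f i) \<le> m" if "i \<in> I" for i using that assms(1) by (auto simp: m_def)
  have "m \<in> (\<lambda>i. dp_val (f i)) ` I" unfolding m_def using assms by (intro Max_in) auto
  then obtain i where i: "i \<in> I" "dp_val (f i) = m" by auto
  have "0 < (\<Sum>i | i \<in> I \<and> dp_val (f i) = m. dp_lead_coeff (f i))"
    using assms i by (intro sum_pos) (auto simp: dp_gt_0_iff)
  then have "0 < dp_coeff (sum f I) m" using dp_sum_leading(1)[OF assms(1) le] by simp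
  note * = dp_posI[OF this dp_sum_leading(2)[OF assms(1) le]]
  show "0 < sum f I" "dp_val (sum f I) = Max ((\<lambda>i. dp_val (f i)) ` I)"
    using * by (simp_all add: m_def)
qed

text \<open>If \<open>y\<close> had the smaller valuation, \<open>x - y\<close> would inherit the
  positive leading term of \<open>x\<close>.\<close>

lemma dp_val_mono:
  assumes "0 < x" "x \<le> y" shows "dp_val x \<le> dp_val y"
proof (rule ccontr)
  assume "\<not> ?thesis"
  then have lt: "dp_val y < dp_val x" by simp
  have "0 < x - y"
  proof (rule dp_posI)
    show "0 < dp_coeff (x - y) (dp_val x)"
      using assms(1) lt by (simp add: dp_coeff_above_val dp_gt_0_iff dp_lead_coeff_def)
    show "dp_coeff (x - y) r = 0" if "dp_val x < r" for r
      using that lt by (simp add: dp_coeff_above_val)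
  qed
  then show False using assms by simp
qed

lemma dp_val_monom [simp]: "a \<noteq> 0 \<Longrightarrow> dp_val (dp_monom a e) = e"
  by (rule dp_val_eqI) (auto simp: dp_coeff_monom)

lemma dp_lead_coeff_monom [simp]: "a \<noteq> 0 \<Longrightarrow> dp_lead_coeff (dp_monom a e) = a"
  by (simp add: dp_lead_coeff_def dp_coeff_monom)

lemma dp_monom_pos [simp]: "0 < a \<Longrightarrow> 0 < dp_monom a e"
  by (rule dp_posI[of _ e]) (auto simp: dp_coeff_monom)

lemma dp_monom_1_nonzero [simp]: "dp_monom 1 e \<noteq> 0"
  using dp_monom_pos[of 1 e] by (metis less_irrefl zero_less_one)

lemma dp_monom_mult: "dp_monom a d * dp_monom b e = dp_monom (a * b) (d + e)"
  by (rule dp_eqI) (auto simp: dp_coeff_monom_mult dp_coeff_monom)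

section \<open>The valuation ring and its residue field\<close>

text \<open>Stated through coefficients because \<open>dp_val 0\<close> is unspecified. On this ring
  the coefficient at exponent 0 is the residue map to the reals.\<close>

definition dp_O :: "dual_puiseux set"
  where "dp_O = {x. \<forall>r>0. dp_coeff x r = 0}"

abbreviation dp_res :: "dual_puiseux \<Rightarrow> real"
  where "dp_res x \<equiv> dp_coeff x 0"

lemma dp_O_iff: "x \<in> dp_O \<longleftrightarrow> x = 0 \<or> dp_val x \<le> 0"
proof
  assume x: "x \<in> dp_O"
  show "x = 0 \<or> dp_val x \<le> 0"
  proof (rule ccontr)
    assume *: "\<not> ?thesis"
    then have "dp_coeff x (dp_val x) = 0" using x by (simp add: dp_O_def)
    then show False using dp_lead_coeff_nonzero[of x] * by (simp add: dp_lead_coeff_def)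
  qed
qed (auto simp: dp_O_def dp_coeff_above_val)

lemma dp_O_closed:
  assumes "x \<in> dp_O" "y \<in> dp_O"
  shows "x + y \<in> dp_O" "x - y \<in> dp_O" "x * y \<in> dp_O"
proof -
  show "x + y \<in> dp_O" "x - y \<in> dp_O" using assms by (auto simp: dp_O_def)
  show "x * y \<in> dp_O"
    using assms by (cases "x = 0 \<or> y = 0") (auto simp: dp_O_iff dp_val_mult)
qed

lemma dp_O_sum: "(\<And>i. i \<in> I \<Longrightarrow> f i \<in> dp_O) \<Longrightarrow> sum f I \<in> dp_O"
  by (simp add: dp_O_def dp_coeff_sum)

lemma dp_res_mult:
  assumes "x \<in> dp_O" "y \<in> dp_O"
  shows "dp_res (x * y) = dp_res x * dp_res y"
proof -
  \<comment> \<open>Two nonpositive exponents with sum 0 are both 0.\<close>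
  have "{p. dp_coeff x p \<noteq> 0 \<and> dp_coeff y (0 - p) \<noteq> 0} \<subseteq> {0}"
  proof
    fix p assume "p \<in> {p. dp_coeff x p \<noteq> 0 \<and> dp_coeff y (0 - p) \<noteq> 0}"
    then have "\<not> 0 < p" "\<not> 0 < 0 - p" using assms unfolding dp_O_def by blast+
    then show "p \<in> {0}" by simp
  qed
  then show ?thesis using dp_coeff_mult[of "{0}" x y 0] by simp
qed

lemma dp_O_val_0:
  assumes "x \<in> dp_O" "dp_res x \<noteq> 0"
  shows "x \<noteq> 0" "dp_val x = 0" "dp_lead_coeff x = dp_res x"
proof -
  show "x \<noteq> 0" using assms by auto
  show v: "dp_val x = 0" by (rule dp_val_eqI) (use assms in \<open>auto simp: dp_O_def\<close>)
  then show "dp_lead_coeff x = dp_res x" by (simp add: dp_lead_coeff_def)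
qed

lemma dp_O_inverse:
  assumes "x \<in> dp_O" "dp_res x \<noteq> 0"
  shows "inverse x \<in> dp_O"
proof -
  note x = dp_O_val_0[OF assms]
  have "dp_val (x * inverse x) = dp_val x + dp_val (inverse x)" using x by (intro dp_val_mult) auto
  moreover have "dp_val (x * inverse x) = 0"
    using x by (simp add: one_dual_puiseux_def)
  ultimately show ?thesis using x by (simp add: dp_O_iff)
qed

text \<open>One pivot step of Gaussian elimination changes the remaining entries only by
  infinitesimals, so the pivots stay units of the valuation ring.\<close>

lemma dp_O_solve_linear_system:
  assumes "finite A"
    and "\<And>a b. a \<in> A \<Longrightarrow> b \<in> A \<Longrightarrow> M a b \<in> dp_O"
    and "\<And>a. a \<in> A \<Longrightarrow> dp_res (M a a) \<noteq> 0"
    and "\<And>a b. a \<in> A \<Longrightarrow> b \<in> A \<Longrightarrow> a \<noteq> b \<Longrightarrow> dp_res (M a b) = 0"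
    and "\<And>a. a \<in> A \<Longrightarrow> r a \<in> dp_O"
  shows "\<exists>y. \<forall>a\<in>A. y a \<in> dp_O \<and> (\<Sum>b\<in>A. M a b * y b) = r a"
  using assms
proof (induction A arbitrary: M r rule: finite_induct)
  case empty
  then show ?case by simp
next
  case (insert c A)
  define q where "q = inverse (M c c)"
  have q: "q \<in> dp_O" unfolding q_def by (rule dp_O_inverse) (use insert.prems in auto)
  have "M c c \<noteq> 0" using insert.prems(2)[of c] by force
  then have qc: "M c c * q = 1" by (simp add: q_def)
  \<comment> \<open>Eliminating the unknown of \<open>c\<close> leaves the Schur complement of the
    pivot \<open>M c c\<close>.\<close>
  define M' where "M' a b = M a b - M a c * (M c b * q)" for a b
  define r' where "r' a = r a - M a c * (r c * q)" for a
  have "\<exists>y. \<forall>a\<in>A. y a \<in> dp_O \<and> (\<Sum>b\<in>A. M' a b * y b) = r' a"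
  proof (rule insert.IH)
    fix a assume a: "a \<in> A"
    then have "a \<noteq> c" using insert.hyps by auto
    then have ac: "dp_res (M a c) = 0" using insert.prems(3) a by simp
    have off: "M a c * (M c b * q) \<in> dp_O" "dp_res (M a c * (M c b * q)) = 0" if "b \<in> A" for b
      using that a q ac insert.prems(1) by (simp_all add: dp_O_closed dp_res_mult)
    show "r' a \<in> dp_O" unfolding r'_def using a q insert.prems(1,4) by (simp add: dp_O_closed)
    show "dp_res (M' a a) \<noteq> 0" using off[OF a] insert.prems(2) a by (simp add: M'_def)
    fix b assume b: "b \<in> A"
    show "M' a b \<in> dp_O" unfolding M'_def using off[OF b] insert.prems(1) a b
      by (simp add: dp_O_closed)
    show "dp_res (M' a b) = 0" if "a \<noteq> b" using off[OF b] insert.prems(3) a b that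
      by (simp add: M'_def)
  qed
  then obtain y where y: "\<And>a. a \<in> A \<Longrightarrow> y a \<in> dp_O" "\<And>a. a \<in> A \<Longrightarrow> (\<Sum>b\<in>A. M' a b * y b) = r' a"
    by blast
  define s where "s = (\<Sum>b\<in>A. M c b * y b)"
  \<comment> \<open>Row \<open>c\<close> determines the eliminated unknown by back
    substitution.\<close>
  define z where "z = y(c := (r c - s) * q)"
  have zA: "(\<Sum>b\<in>A. M a b * z b) = (\<Sum>b\<in>A. M a b * y b)" for a
    by (rule sum.cong) (use insert.hyps in \<open>auto simp: z_def\<close>)
  have sum_z: "(\<Sum>b\<in>insert c A. M a b * z b) = M a c * ((r c - s) * q) + (\<Sum>b\<in>A. M a b * y b)" for a
    using insert.hyps zA by (simp add: z_def)
  have "z a \<in> dp_O \<and> (\<Sum>b\<in>insert c A. M a b * z b) = r a" if a: "a \<in> insert c A" for a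
  proof
    have "s \<in> dp_O" unfolding s_def by (intro dp_O_sum dp_O_closed) (use y insert.prems in auto)
    then have "(r c - s) * q \<in> dp_O" using q insert.prems(4) by (simp add: dp_O_closed)
    then show "z a \<in> dp_O" using a y by (auto simp: z_def)
    show "(\<Sum>b\<in>insert c A. M a b * z b) = r a"
    proof (cases "a = c")
      case True
      have "M c c * ((r c - s) * q) = (M c c * q) * (r c - s)" by (simp only: mult_ac)
      also have "\<dots> = r c - s" using qc by simp
      finally have "M c c * ((r c - s) * q) + s = r c" by (simp only: diff_add_cancel)
      then show ?thesis unfolding True sum_z s_def[symmetric] .
    next
      case False
      then have "r' a = (\<Sum>b\<in>A. M' a b * y b)" using y a by simp
      also have "\<dots> = (\<Sum>b\<in>A. M a b * y b) - M a c * q * s"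
        by (simp add: M'_def s_def algebra_simps sum_subtractf sum_distrib_left)
      finally show ?thesis using sum_z[of a] by (simp add: r'_def algebra_simps)
    qed
  qed
  then show ?case by blast
qed

section \<open>Lifting tropical Voronoi cells\<close>

definition dp_dot :: "dual_puiseux ^ 'n \<Rightarrow> dual_puiseux ^ 'n \<Rightarrow> dual_puiseux"
  where "dp_dot x a = (\<Sum>i\<in>UNIV. x $ i * a $ i)"

text \<open>The max-plus form whose coefficients are the valuations of \<open>a\<close>;
  \<open>dp_val_dot\<close> identifies it as the tropicalization of \<open>dp_dot x a\<close> on
  positive vectors.\<close>

definition trop_eval :: "real ^ 'n \<Rightarrow> dual_puiseux ^ 'n \<Rightarrow> real"
  where "trop_eval w a = Max (range (\<lambda>i. w $ i + dp_val (a $ i)))"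

lemma trop_eval_ge: "w $ i + dp_val (a $ i) \<le> trop_eval w a"
  unfolding trop_eval_def by (rule Max_ge) auto

lemma trop_eval_le_iff: "trop_eval w a \<le> m \<longleftrightarrow> (\<forall>i. w $ i + dp_val (a $ i) \<le> m)"
  unfolding trop_eval_def by (subst Max_le_iff) auto

lemma trop_eval_attained: "\<exists>i. w $ i + dp_val (a $ i) = trop_eval w a"
proof -
  have "trop_eval w a \<in> range (\<lambda>i. w $ i + dp_val (a $ i))"
    unfolding trop_eval_def by (rule Max_in) auto
  then show ?thesis by force
qed

text \<open>The shift does not depend on \<open>a\<close>, so comparisons between sites are
  unaffected by the choice of representative modulo the all-ones vector.\<close>

lemma trop_eval_trop_proj:
  fixes w :: "real ^ 'n"
  shows "trop_eval (trop_proj w) a = trop_eval w a - (\<Sum>j\<in>UNIV. w $ j) / real CARD('n)"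
proof -
  define c where "c = (\<Sum>j\<in>UNIV. w $ j) / real CARD('n)"
  have "mono (\<lambda>t. t - c)" by (rule monoI) simp
  from mono_Max_commute[OF this, of "range (\<lambda>i. w $ i + dp_val (a $ i))"]
  show ?thesis
    by (simp add: trop_eval_def trop_proj_def image_image c_def algebra_simps)
qed

lemma trop_proj_in_trop_H: "trop_proj w \<in> trop_H"
  by (simp add: trop_H_def trop_proj_def sum_subtractf)

lemma trop_proj_id: "w \<in> trop_H \<Longrightarrow> trop_proj w = w"
  by (simp add: trop_H_def trop_proj_def vec_eq_iff)

lemma power_region_iff:
  "x \<in> power_region SS a \<longleftrightarrow> (\<forall>i. 0 \<le> x $ i) \<and> (\<forall>b\<in>SS. dp_dot x a \<le> dp_dot x b)"
proof -
  have "dp_sqnorm (x - b) - dp_sqnorm b = dp_sqnorm x - 2 * dp_dot x b" for b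
    by (simp add: dp_sqnorm_def dp_dot_def power2_diff sum.distrib sum_subtractf sum_distrib_left
        algebra_simps)
  then show ?thesis by (simp add: power_region_def)
qed

lemma dp_val_dot:
  assumes "\<And>i. 0 < x $ i" "\<And>i. 0 < a $ i"
  shows "0 < dp_dot x a" "dp_val (dp_dot x a) = trop_eval (dp_vec_val x) a"
proof -
  have v: "dp_val (x $ i * a $ i) = dp_vec_val x $ i + dp_val (a $ i)" for i
    using assms[of i] by (simp add: dp_val_mult dp_vec_val_def dp_gt_0_iff)
  show "0 < dp_dot x a" "dp_val (dp_dot x a) = trop_eval (dp_vec_val x) a"
    using dp_val_sum_pos[of UNIV "\<lambda>i. x $ i * a $ i"] assms
    by (simp_all add: dp_dot_def trop_eval_def v)
qed

text \<open>Sites whose valuations differ in every coordinate attain equal tropical evaluations in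
  disjoint sets of coordinates. Hence only finitely many sites can be tied, and their defining
  equations decouple modulo infinitesimals.\<close>

locale dp_sites =
  fixes SS :: "(dual_puiseux ^ 'n) set"
  assumes site_pos: "a \<in> SS \<Longrightarrow> 0 < a $ i"
    and site_generic: "a \<in> SS \<Longrightarrow> b \<in> SS \<Longrightarrow> dp_val (a $ i) = dp_val (b $ i) \<Longrightarrow> a = b"
begin

text \<open>Not confined to \<open>trop_H\<close>, so that single coordinates can be raised; cutting
  with \<open>trop_H\<close> recovers intersections of Voronoi regions.\<close>

definition trop_cell :: "(dual_puiseux ^ 'n) set \<Rightarrow> (real ^ 'n) set"
  where "trop_cell A = {w. \<forall>a\<in>A. \<forall>b\<in>SS. trop_eval w a \<le> trop_eval w b}"

text \<open>Sites reaching \<open>m\<close> at the same coordinate coincide. Only attainment of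
  \<open>m\<close> is asked, so that this applies to points with zero coordinates, whose valuations
  are arbitrary there.\<close>

lemma finite_tied:
  assumes "A \<subseteq> SS" "\<And>a. a \<in> A \<Longrightarrow> \<exists>i. w $ i + dp_val (a $ i) = m"
  shows "finite A"
proof -
  obtain p where p: "\<And>a. a \<in> A \<Longrightarrow> w $ p a + dp_val (a $ p a) = m" using assms(2) by metis
  have "inj_on p A"
  proof (rule inj_onI)
    fix a b assume *: "a \<in> A" "b \<in> A" "p a = p b"
    then have "dp_val (a $ p a) = dp_val (b $ p a)" using p[of a] p[of b] by simp
    then show "a = b" using site_generic * assms(1) by blast
  qed
  then show ?thesis by (rule inj_on_finite[of p A UNIV]) auto
qed

lemma trop_cell_common_value:
  assumes "w \<in> trop_cell A" "A \<subseteq> SS" "A \<noteq> {}"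
  obtains m where "\<And>a. a \<in> A \<Longrightarrow> trop_eval w a = m" "\<And>b. b \<in> SS \<Longrightarrow> m \<le> trop_eval w b" "finite A"
proof -
  obtain a0 where a0: "a0 \<in> A" using assms by blast
  have eq: "trop_eval w a = trop_eval w a0" if "a \<in> A" for a
    using that a0 assms by (auto simp: trop_cell_def intro!: antisym)
  have "finite A"
  proof (rule finite_tied[OF assms(2)])
    show "\<exists>i. w $ i + dp_val (a $ i) = trop_eval w a0" if "a \<in> A" for a
      using trop_eval_attained[of w a] eq[OF that] by simp
  qed
  moreover have "trop_eval w a0 \<le> trop_eval w b" if "b \<in> SS" for b
    using assms(1) a0 that unfolding trop_cell_def by blast
  ultimately show thesis using that[of "trop_eval w a0"] eq by blast
qed

text \<open>Gives the reflection of inclusions: a nonempty cell of \<open>A\<close> can lie in that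
  of \<open>B\<close> only if \<open>B\<close> is a subset of \<open>A\<close>.\<close>

lemma trop_cell_separate:
  assumes w: "w \<in> trop_cell A" and A: "A \<subseteq> SS" "A \<noteq> {}" and b: "b \<in> SS" "b \<notin> A"
  shows "\<exists>w'\<in>trop_cell A. w' \<notin> trop_cell {b}"
proof (cases "w \<in> trop_cell {b}")
  case True
  obtain m where m: "\<And>a. a \<in> A \<Longrightarrow> trop_eval w a = m" "\<And>b. b \<in> SS \<Longrightarrow> m \<le> trop_eval w b" "finite A"
    using trop_cell_common_value[OF w A] by metis
  have "trop_eval w b = m"
  proof (rule antisym)
    obtain a where a: "a \<in> A" using A by blast
    then have "trop_eval w b \<le> trop_eval w a" using True A by (auto simp: trop_cell_def)
    then show "trop_eval w b \<le> m" using m(1)[OF a] by simp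
  qed (rule m(2)[OF b(1)])
  then obtain i where i: "w $ i + dp_val (b $ i) = m" using trop_eval_attained by metis
  \<comment> \<open>The least slack of the sites of \<open>A\<close> in coordinate \<open>i\<close>,
    positive because \<open>b\<close> already reaches \<open>m\<close> there and distinct sites have
    distinct valuations. Raising by \<open>e\<close> keeps their evaluations at most
    \<open>m\<close> and pushes that of \<open>b\<close> beyond it.\<close>
  define e where "e = Min ((\<lambda>a. m - w $ i - dp_val (a $ i)) ` A)"
  have "0 < m - w $ i - dp_val (a $ i)" if "a \<in> A" for a
  proof -
    have "w $ i + dp_val (a $ i) \<le> m" using trop_eval_ge m that by metis
    moreover have "dp_val (a $ i) \<noteq> dp_val (b $ i)" using site_generic[of a b i] that A b by auto
    ultimately show ?thesis using i by linarith
  qed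
  then have e0: "0 < e" using m(3) A by (simp add: e_def)
  have e: "e \<le> m - w $ i - dp_val (a $ i)" if "a \<in> A" for a
    using that m(3) by (simp add: e_def)
  define w' where "w' = (\<chi> j. if j = i then w $ i + e else w $ j)"
  have ge: "w $ j \<le> w' $ j" for j using e0 by (simp add: w'_def)
  have a_le: "trop_eval w' a \<le> m" if "a \<in> A" for a
    unfolding trop_eval_le_iff using e[OF that] trop_eval_ge[of w _ a] m(1)[OF that]
    by (auto simp: w'_def)
  have c_ge: "m \<le> trop_eval w' c" if "c \<in> SS" for c
  proof -
    have "trop_eval w c \<le> trop_eval w' c"
      unfolding trop_eval_le_iff using ge trop_eval_ge[of w' _ c]
      by (meson add_right_mono order_trans)
    then show ?thesis using m(2)[OF that] by simp
  qed
  have "m + e \<le> trop_eval w' b" using trop_eval_ge[of w' i b] i by (simp add: w'_def)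
  moreover obtain a where "a \<in> A" using A by blast
  ultimately have "a \<in> SS" "\<not> trop_eval w' b \<le> trop_eval w' a"
    using a_le[of a] e0 A by auto
  then have "w' \<notin> trop_cell {b}" unfolding trop_cell_def by blast
  moreover have "w' \<in> trop_cell A"
    unfolding trop_cell_def using a_le c_ge by (auto intro: order_trans)
  ultimately show ?thesis by blast
qed (use w in blast)

text \<open>Zero coordinates are replaced by coordinates of very negative valuation, which do not
  affect the tropical evaluations at the finitely many sites of \<open>A\<close>.\<close>

lemma trop_cell_nonempty:
  assumes A: "A \<subseteq> SS" "A \<noteq> {}" and x: "\<And>a. a \<in> A \<Longrightarrow> x \<in> power_region SS a" and "x \<noteq> 0"
  shows "trop_cell A \<noteq> {}"
proof -
  define J where "J = {i. x $ i \<noteq> 0}"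
  have J: "J \<noteq> {}" using \<open>x \<noteq> 0\<close> by (auto simp: J_def vec_eq_iff)
  obtain a0 where a0: "a0 \<in> A" using A by blast
  have xpos: "0 < x $ i" if "i \<in> J" for i
    using x[OF a0] that by (simp add: power_region_iff J_def order_less_le)
  define v where "v b = Max ((\<lambda>i. dp_val (x $ i) + dp_val (b $ i)) ` J)" for b :: "dual_puiseux ^ 'n"
  have dot: "0 < dp_dot x b" "dp_val (dp_dot x b) = v b" if "b \<in> SS" for b
  proof -
    have "dp_dot x b = (\<Sum>i\<in>J. x $ i * b $ i)"
      unfolding dp_dot_def by (rule sum.mono_neutral_right) (auto simp: J_def)
    moreover have "dp_val (x $ i * b $ i) = dp_val (x $ i) + dp_val (b $ i)" if "i \<in> J" for i
      using xpos[OF that] site_pos[OF \<open>b \<in> SS\<close>, of i] by (intro dp_val_mult) auto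
    ultimately show "0 < dp_dot x b" "dp_val (dp_dot x b) = v b"
      using dp_val_sum_pos[of J "\<lambda>i. x $ i * b $ i"] J xpos site_pos[OF that]
      by (simp_all add: v_def cong: image_cong)
  qed
  have v_le: "v a \<le> v b" if "a \<in> A" "b \<in> SS" for a b
    using dp_val_mono[of "dp_dot x a" "dp_dot x b"] x[of a] that dot[of a] dot[of b] A
    by (auto simp: power_region_iff)
  define m where "m = v a0"
  have m: "v a = m" if "a \<in> A" for a
    using v_le[of a a0] v_le[of a0 a] that a0 A by (auto simp: m_def intro: antisym)
  have fin: "finite A"
  proof (rule finite_tied[OF A(1)])
    fix a assume "a \<in> A"
    \<comment> \<open>The attaining index lies in \<open>J\<close>, where the entries of
      \<open>dp_vec_val x\<close> are meaningful.\<close>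
    have "v a \<in> (\<lambda>i. dp_val (x $ i) + dp_val (a $ i)) ` J"
      unfolding v_def using J by (intro Max_in) auto
    then show "\<exists>i. dp_vec_val x $ i + dp_val (a $ i) = m" using m[OF \<open>a \<in> A\<close>] by (auto simp: dp_vec_val_def)
  qed
  \<comment> \<open>Low enough that no coordinate outside \<open>J\<close> exceeds \<open>m\<close>
    at a site of \<open>A\<close>; at other sites extra coordinates can only raise the
    maximum.\<close>
  define K where "K = Min ((\<lambda>(a, i). m - dp_val (a $ i)) ` (A \<times> UNIV))"
  have K: "K \<le> m - dp_val (a $ i)" if "a \<in> A" for a i
    unfolding K_def using fin that by (intro Min_le) auto
  define w where "w = (\<chi> i. if i \<in> J then dp_val (x $ i) else K)"
  have "trop_eval w a \<le> m" if "a \<in> A" for a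
  proof -
    have "dp_val (x $ i) + dp_val (a $ i) \<le> m" if "i \<in> J" for i
      unfolding m[OF \<open>a \<in> A\<close>, symmetric] v_def using that by (intro Max_ge) auto
    then show ?thesis unfolding trop_eval_le_iff using K[OF that] by (auto simp: w_def algebra_simps)
  qed
  moreover have "m \<le> trop_eval w b" if "b \<in> SS" for b
  proof -
    have "v b \<le> trop_eval w b"
    proof -
      have "dp_val (x $ i) + dp_val (b $ i) \<le> trop_eval w b" if "i \<in> J" for i
        using trop_eval_ge[of w i b] that by (simp add: w_def)
      then show ?thesis unfolding v_def using J by (subst Max_le_iff) auto
    qed
    then show ?thesis using v_le[OF a0 that] by (simp add: m_def)
  qed
  ultimately have "w \<in> trop_cell A" unfolding trop_cell_def by (auto intro: order_trans)
  then show ?thesis by blast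
qed

text \<open>The leading coefficients of the lift are chosen so that the linear forms of the sites in
  \<open>A\<close> have leading coefficient \<open>1\<close>, and those of the other tied sites at least \<open>2\<close>. Exact
  equality on \<open>A\<close> is then reached by correcting one coordinate per site of \<open>A\<close>.\<close>

lemma trop_cell_lift:
  assumes w: "w \<in> trop_cell A" and A: "A \<subseteq> SS" "A \<noteq> {}"
  shows "\<exists>x. (\<forall>i. 0 < x $ i) \<and> dp_vec_val x = w \<and> (\<forall>a\<in>A. x \<in> power_region SS a)"
proof -
  obtain m where m: "\<And>a. a \<in> A \<Longrightarrow> trop_eval w a = m" "\<And>b. b \<in> SS \<Longrightarrow> m \<le> trop_eval w b" "finite A"
    using trop_cell_common_value[OF w A] by metis
  define I where "I b = {i. w $ i + dp_val (b $ i) = m}" for b :: "dual_puiseux ^ 'n"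
  have I_disj: "a = b" if "i \<in> I a" "i \<in> I b" "a \<in> SS" "b \<in> SS" for i a b
    using site_generic[of a b i] that by (simp add: I_def)
  have I_ne: "I a \<noteq> {}" if "trop_eval w a = m" for a
    using trop_eval_attained[of w a] that by (auto simp: I_def)
  have lc_pos: "0 < dp_lead_coeff (b $ i)" if "b \<in> SS" for b i
    using site_pos[OF that] by (simp add: dp_gt_0_iff)
  \<comment> \<open>At most one site reaches the value \<open>m\<close> at coordinate
    \<open>i\<close>, so \<open>THE\<close> is well defined. The factor
    \<open>1 / real (card (I b))\<close> spreads a total of 1 over \<open>I b\<close>; the final 1
    is an arbitrary positive choice.\<close>
  define u where "u i = (if \<exists>b\<in>SS. i \<in> I b then
      let b = THE b. b \<in> SS \<and> i \<in> I b in
        (if b \<in> A then 1 / real (card (I b)) else 2) / dp_lead_coeff (b $ i)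
      else 1)" for i
  have u_I: "u i = (if b \<in> A then 1 / real (card (I b)) else 2) / dp_lead_coeff (b $ i)"
    if "b \<in> SS" "i \<in> I b" for b i
  proof -
    have "(THE b. b \<in> SS \<and> i \<in> I b) = b" using that I_disj by (intro the_equality) auto
    then show ?thesis using that by (auto simp: u_def Let_def)
  qed
  have u_pos: "0 < u i" for i
  proof (cases "\<exists>b\<in>SS. i \<in> I b")
    case True
    then obtain b where b: "b \<in> SS" "i \<in> I b" by blast
    then have "0 < card (I b)" by (auto simp: card_gt_0_iff)
    then show ?thesis using u_I[OF b] lc_pos[OF b(1)] by simp
  qed (simp add: u_def)
  have u_sum_A: "(\<Sum>i\<in>I a. dp_lead_coeff (a $ i) * u i) = 1" if "a \<in> A" for a
  proof -
    have "(\<Sum>i\<in>I a. dp_lead_coeff (a $ i) * u i) = (\<Sum>i\<in>I a. 1 / real (card (I a)))"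
    proof (rule sum.cong[OF refl])
      fix i assume i: "i \<in> I a"
      have "a \<in> SS" using that A by blast
      then show "dp_lead_coeff (a $ i) * u i = 1 / real (card (I a))"
        using u_I[of a i] i that lc_pos[of a i] by simp
    qed
    then show ?thesis using I_ne[OF m(1)[OF that]] by simp
  qed
  have "\<forall>a\<in>A. \<exists>i. i \<in> I a" using I_ne m(1) by (simp add: ex_in_conv)
  then obtain p where p: "\<And>a. a \<in> A \<Longrightarrow> p a \<in> I a" using bchoice by metis
  have p_inj: "inj_on p A" using p I_disj A by (intro inj_onI) (metis subsetD)
  \<comment> \<open>Substituting \<open>x $ i = dp_monom 1 (w $ i) * z i\<close> turns
    \<open>dp_dot x a = dp_monom 1 m\<close> into the condition that the \<open>e a i * z i\<close>
    sum to 1, now with coefficients in \<open>dp_O\<close>.\<close>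
  define e where "e a i = dp_monom 1 (w $ i - m) * a $ i" for a :: "dual_puiseux ^ 'n" and i
  have e: "e a i \<in> dp_O" "dp_res (e a i) = (if i \<in> I a then dp_lead_coeff (a $ i) else 0)"
    if "a \<in> A" for a i
  proof -
    have le: "w $ i + dp_val (a $ i) \<le> m" using trop_eval_ge m(1) that by metis
    have "a $ i \<noteq> 0" using site_pos[of a i] that A by auto
    then have "dp_val (e a i) = w $ i - m + dp_val (a $ i)"
      unfolding e_def by (subst dp_val_mult) auto
    then show "e a i \<in> dp_O" using le by (simp add: dp_O_iff)
    have c: "dp_res (e a i) = dp_coeff (a $ i) (m - w $ i)"
      by (simp add: e_def dp_coeff_monom_mult)
    show "dp_res (e a i) = (if i \<in> I a then dp_lead_coeff (a $ i) else 0)"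
    proof (cases "i \<in> I a")
      case True
      then have "m - w $ i = dp_val (a $ i)" by (simp add: I_def)
      then show ?thesis using True c by (simp add: dp_lead_coeff_def)
    next
      case False
      then have "dp_val (a $ i) < m - w $ i" using le by (simp add: I_def)
      then show ?thesis using False c by (simp add: dp_coeff_above_val)
    qed
  qed
  have uO: "dp_monom (u i) 0 \<in> dp_O" "dp_res (dp_monom (u i) 0) = u i" for i
    by (auto simp: dp_O_def dp_coeff_monom)
  \<comment> \<open>The part of 1 left for the pivot coordinates once all others carry the constants
    \<open>u i\<close>.\<close>
  define r where "r a = 1 - (\<Sum>i\<in>- p ` A. e a i * dp_monom (u i) 0)" for a
  have r: "r a \<in> dp_O" "dp_res (r a) = dp_lead_coeff (a $ p a) * u (p a)" if "a \<in> A" for a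
  proof -
    have "1 \<in> dp_O" by (simp add: dp_O_def dp_coeff_1)
    then show "r a \<in> dp_O" unfolding r_def using e(1)[OF that] uO(1)
      by (intro dp_O_closed dp_O_sum) auto
    \<comment> \<open>Among the pivots only \<open>p a\<close> meets \<open>I a\<close>, so the
      residue of \<open>r a\<close> is exactly what the prescribed coefficient contributes at
      \<open>p a\<close>.\<close>
    have pI: "p ` A \<inter> I a = {p a}"
    proof -
      have "b = a" if "b \<in> A" "p b \<in> I a" for b
        using I_disj[of "p b" b a] p[of b] that A \<open>a \<in> A\<close> by auto
      then show ?thesis using p that by auto
    qed
    have "dp_res (r a) = 1 - (\<Sum>i\<in>- p ` A. if i \<in> I a then dp_lead_coeff (a $ i) * u i else 0)"
      unfolding r_def using e[OF that] uO
      by (simp add: dp_coeff_sum dp_coeff_1 dp_res_mult if_distrib[of "\<lambda>x. x * _"] cong: if_cong)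
    also have "\<dots> = 1 - (\<Sum>i\<in>I a - {p a}. dp_lead_coeff (a $ i) * u i)"
    proof -
      have "- p ` A \<inter> I a = I a - {p a}" using pI by auto
      then show ?thesis by (simp add: sum.inter_restrict[symmetric])
    qed
    also have "\<dots> = dp_lead_coeff (a $ p a) * u (p a)"
      using u_sum_A[OF that] p[OF that] by (simp add: sum_diff1)
    finally show "dp_res (r a) = dp_lead_coeff (a $ p a) * u (p a)" .
  qed
  have res_M: "dp_res (e a (p b)) = (if a = b then dp_lead_coeff (a $ p a) else 0)"
    if "a \<in> A" "b \<in> A" for a b
    using e(2)[OF that(1), of "p b"] p[OF that(1)] p[OF that(2)] I_disj[of "p b" a b] that A
    by auto
  have "\<exists>y. \<forall>a\<in>A. y a \<in> dp_O \<and> (\<Sum>b\<in>A. e a (p b) * y b) = r a"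
  proof (rule dp_O_solve_linear_system[OF m(3)])
    show "dp_res (e a (p a)) \<noteq> 0" if "a \<in> A" for a
      using res_M[OF that that] lc_pos[of a "p a"] that A by auto
  qed (use e res_M r in auto)
  then obtain y where y: "\<And>a. a \<in> A \<Longrightarrow> y a \<in> dp_O" "\<And>a. a \<in> A \<Longrightarrow> (\<Sum>b\<in>A. e a (p b) * y b) = r a"
    by blast
  \<comment> \<open>Modulo infinitesimals the solved system is diagonal, so each solution has the
    prescribed residue and the correction preserves valuations and leading coefficients.\<close>
  have y_res: "dp_res (y a) = u (p a)" if "a \<in> A" for a
  proof -
    have "dp_res (r a) = (\<Sum>b\<in>A. dp_res (e a (p b)) * dp_res (y b))"
      unfolding y(2)[OF that, symmetric] dp_coeff_sum
      by (rule sum.cong) (use e(1)[OF that] y(1) in \<open>auto simp: dp_res_mult\<close>)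
    also have "\<dots> = (\<Sum>b\<in>A. if b = a then dp_lead_coeff (a $ p a) * dp_res (y a) else 0)"
      by (rule sum.cong) (use res_M[OF that] in auto)
    also have "\<dots> = dp_lead_coeff (a $ p a) * dp_res (y a)" using that m(3) by simp
    finally show ?thesis using r(2)[OF that] lc_pos[of a "p a"] that A by auto
  qed
  define z where "z i = (if i \<in> p ` A then y (inv_into A p i) else dp_monom (u i) 0)" for i
  have z_p: "z (p a) = y a" if "a \<in> A" for a using that p_inj by (simp add: z_def)
  have z: "z i \<in> dp_O" "dp_res (z i) = u i" for i
  proof -
    have "z i \<in> dp_O \<and> dp_res (z i) = u i"
    proof (cases "i \<in> p ` A")
      case True
      then show ?thesis using z_p y y_res by auto
    qed (use uO in \<open>simp add: z_def\<close>)
    then show "z i \<in> dp_O" "dp_res (z i) = u i" by auto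
  qed
  have z_eq: "(\<Sum>i\<in>UNIV. e a i * z i) = 1" if "a \<in> A" for a
  proof -
    have "(\<Sum>i\<in>UNIV. e a i * z i) = (\<Sum>i\<in>p ` A. e a i * z i) + (\<Sum>i\<in>- p ` A. e a i * z i)"
      by (subst sum.union_disjoint[symmetric]) auto
    also have "(\<Sum>i\<in>p ` A. e a i * z i) = r a"
      using y(2)[OF that] by (simp add: sum.reindex[OF p_inj] z_p)
    also have "(\<Sum>i\<in>- p ` A. e a i * z i) = 1 - r a" by (simp add: r_def z_def)
    finally show ?thesis by simp
  qed
  define x where "x = (\<chi> i. dp_monom 1 (w $ i) * z i)"
  have x: "0 < x $ i" "dp_val (x $ i) = w $ i" "dp_lead_coeff (x $ i) = u i" for i
  proof -
    have "dp_res (z i) \<noteq> 0" using z[of i] u_pos[of i] by simp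
    note zi = dp_O_val_0[OF z(1)[of i] this]
    show v: "dp_val (x $ i) = w $ i" and l: "dp_lead_coeff (x $ i) = u i"
      using dp_val_mult[OF dp_monom_1_nonzero zi(1)] zi z(2)[of i] by (simp_all add: x_def)
    show "0 < x $ i" using dp_val_mult(1)[OF dp_monom_1_nonzero zi(1)] l u_pos[of i]
      by (simp add: dp_gt_0_iff x_def)
  qed
  have xw: "dp_vec_val x = w" by (simp add: dp_vec_val_def x(2) vec_eq_iff)
  have dot_A: "dp_dot x a = dp_monom 1 m" if "a \<in> A" for a
  proof -
    have "x $ i * a $ i = dp_monom 1 m * (e a i * z i)" for i
    proof -
      have "dp_monom 1 m * (e a i * z i) = (dp_monom 1 m * dp_monom 1 (w $ i - m)) * a $ i * z i"
        by (simp add: e_def mult_ac)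
      also have "\<dots> = x $ i * a $ i"
        unfolding dp_monom_mult by (simp add: x_def mult_ac)
      finally show ?thesis by (rule sym)
    qed
    then have "dp_dot x a = dp_monom 1 m * (\<Sum>i\<in>UNIV. e a i * z i)"
      by (simp add: dp_dot_def sum_distrib_left)
    then show ?thesis using z_eq[OF that] by simp
  qed
  have dot_ge: "dp_monom 1 m \<le> dp_dot x b" if b: "b \<in> SS" for b
  proof (cases "b \<in> A")
    case False
    define k where "k = trop_eval w b"
    have mk: "m \<le> k" using m(2)[OF b] by (simp add: k_def)
    have val: "dp_val (dp_dot x b) = k" and pos: "0 < dp_dot x b"
      using dp_val_dot[of x b] x site_pos[OF b] by (auto simp: xw k_def)
    \<comment> \<open>For \<open>m < k\<close> the monomial lies below the leading term of
      \<open>dp_dot x b\<close>. Only a tie needs the factor 2 in \<open>u\<close>, which makes the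
      coefficient at least 2.\<close>
    have lead: "1 < dp_coeff (dp_dot x b) k" if "k = m"
    proof -
      have bi: "b $ i \<noteq> 0" "x $ i \<noteq> 0" for i using site_pos[OF b, of i] x(1)[of i] by auto
      have vi: "dp_val (x $ i * b $ i) = w $ i + dp_val (b $ i)"
        "dp_lead_coeff (x $ i * b $ i) = u i * dp_lead_coeff (b $ i)" for i
        using dp_val_mult[OF bi(2) bi(1), of i i] x by auto
      have le: "dp_val (x $ i * b $ i) \<le> m" for i
        using trop_eval_ge[of w i b] that by (simp add: vi k_def)
      have "dp_coeff (dp_dot x b) m = (\<Sum>i\<in>I b. u i * dp_lead_coeff (b $ i))"
        unfolding dp_dot_def using dp_sum_leading(1)[of UNIV "\<lambda>i. x $ i * b $ i" m] le
        by (simp add: vi I_def)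
      also have "\<dots> = (\<Sum>i\<in>I b. 2)"
      proof (rule sum.cong[OF refl])
        fix i assume "i \<in> I b"
        then show "u i * dp_lead_coeff (b $ i) = 2" using u_I[OF b] False lc_pos[OF b, of i] by simp
      qed
      also have "\<dots> = 2 * real (card (I b))" by simp
      finally have "dp_coeff (dp_dot x b) m = 2 * real (card (I b))" .
      moreover have "0 < card (I b)" using I_ne[of b] that by (simp add: k_def card_gt_0_iff)
      ultimately show ?thesis using that by simp
    qed
    have "0 < dp_dot x b - dp_monom 1 m"
    proof (rule dp_posI)
      show "0 < dp_coeff (dp_dot x b - dp_monom 1 m) k"
        using lead pos val by (auto simp: dp_coeff_monom dp_gt_0_iff dp_lead_coeff_def)
      show "dp_coeff (dp_dot x b - dp_monom 1 m) s = 0" if "k < s" for s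
        using that mk val by (simp add: dp_coeff_monom dp_coeff_above_val)
    qed
    then show ?thesis by simp
  qed (simp add: dot_A)
  show ?thesis
    using x(1) xw dot_A dot_ge by (intro exI[of _ x]) (auto simp: power_region_iff less_imp_le)
qed

section \<open>Images of the cells of the power diagram\<close>

lemma trop_proj_in_trop_cell: "trop_proj w \<in> trop_cell A \<longleftrightarrow> w \<in> trop_cell A"
  by (simp add: trop_cell_def trop_eval_trop_proj)

lemma trop_cell_INT: "A \<noteq> {} \<Longrightarrow> (\<Inter>a\<in>A. trop_cell {a} \<inter> trop_H) = trop_cell A \<inter> trop_H"
  by (auto simp: trop_cell_def)

text \<open>Taking valuations of the inequalities gives one inclusion. The other needs a single lift
  that serves all sites of \<open>A\<close> at once, since images do not commute with intersections
  in general.\<close>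

lemma val_image_INT_power_region:
  assumes A: "A \<subseteq> SS" "A \<noteq> {}"
  shows "val_image (\<Inter>a\<in>A. power_region SS a) = trop_cell A \<inter> trop_H"
proof (intro equalityI subsetI)
  fix v assume "v \<in> val_image (\<Inter>a\<in>A. power_region SS a)"
  then obtain x where x: "\<And>a. a \<in> A \<Longrightarrow> x \<in> power_region SS a" "\<And>i. 0 < x $ i"
    "v = trop_proj (dp_vec_val x)"
    by (auto simp: val_image_def)
  have "trop_eval (dp_vec_val x) a \<le> trop_eval (dp_vec_val x) b" if "a \<in> A" "b \<in> SS" for a b
  proof -
    have a: "a \<in> SS" using that A by blast
    have "dp_dot x a \<le> dp_dot x b" using x(1)[OF that(1)] that(2) by (simp add: power_region_iff)
    then show ?thesis using dp_val_mono dp_val_dot[OF x(2)] site_pos[OF a] site_pos[OF that(2)]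
      by metis
  qed
  then have "dp_vec_val x \<in> trop_cell A" by (simp add: trop_cell_def)
  then show "v \<in> trop_cell A \<inter> trop_H"
    using x(3) trop_proj_in_trop_cell trop_proj_in_trop_H by simp
next
  fix w assume w: "w \<in> trop_cell A \<inter> trop_H"
  then obtain x where x: "\<And>i. 0 < x $ i" "dp_vec_val x = w" "\<And>a. a \<in> A \<Longrightarrow> x \<in> power_region SS a"
    using trop_cell_lift[OF _ A, of w] by blast
  have "w = trop_proj (dp_vec_val x)" using w x(2) by (simp add: trop_proj_id)
  then show "w \<in> val_image (\<Inter>a\<in>A. power_region SS a)" using x by (auto simp: val_image_def)
qed

text \<open>The origin lies in every power region. So if the tropical cell of \<open>A\<close> is empty then the
  intersection over \<open>A\<close> is the least element of the diagram, and otherwise the tropical cell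
  determines \<open>A\<close>.\<close>

lemma val_image_reflects_subset:
  assumes A: "A \<subseteq> SS" "A \<noteq> {}" and B: "B \<subseteq> SS" "B \<noteq> {}"
    and sub: "val_image (\<Inter>a\<in>A. power_region SS a) \<subseteq> val_image (\<Inter>b\<in>B. power_region SS b)"
  shows "(\<Inter>a\<in>A. power_region SS a) \<subseteq> (\<Inter>b\<in>B. power_region SS b)"
proof (cases "trop_cell A = {}")
  case True
  have "x = 0" if "x \<in> (\<Inter>a\<in>A. power_region SS a)" for x
    using trop_cell_nonempty[OF A, of x] True that by auto
  moreover have "0 \<in> (\<Inter>b\<in>B. power_region SS b)" by (simp add: power_region_iff dp_dot_def)
  ultimately show ?thesis by blast
next
  case False
  then obtain w where w: "w \<in> trop_cell A" by blast
  have "B \<subseteq> A"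
  proof
    fix b assume b: "b \<in> B"
    show "b \<in> A"
    proof (rule ccontr)
      assume "b \<notin> A"
      then obtain w' where w': "w' \<in> trop_cell A" "w' \<notin> trop_cell {b}"
        using trop_cell_separate[OF w A] b B by blast
      then have "trop_proj w' \<in> trop_cell A \<inter> trop_H"
        using trop_proj_in_trop_cell trop_proj_in_trop_H by simp
      then have "trop_proj w' \<in> trop_cell B"
        using sub val_image_INT_power_region[OF A] val_image_INT_power_region[OF B] by auto
      then have "w' \<in> trop_cell {b}" using trop_proj_in_trop_cell b by (simp add: trop_cell_def)
      then show False using w' by simp
    qed
  qed
  then show ?thesis by auto
qed

end

section \<open>Assembling the isomorphism of diagrams\<close>

theorem theorem5p3:
  fixes S :: "(real ^ 'n) set" and SS :: "(dual_puiseux ^ 'n) set"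
  assumes "CARD('n) \<ge> 2"
    and "S \<subseteq> trop_H" and "S \<noteq> {}" and "super_discrete S" and "general_position S"
    and "SS \<subseteq> dp_H" and "bij_betw dp_vec_val SS (uminus ` S)"
  shows "(\<forall>a\<in>SS. - dp_vec_val a \<in> S \<and>
            val_image (power_region SS a) = voronoi_region S (- dp_vec_val a)) \<and>
         poset_iso val_image (power_diagram SS) (voronoi_diagram S)"
proof -
  let ?s = "\<lambda>a. - dp_vec_val a :: real ^ 'n"
  have S_eq: "?s ` SS = S"
    using assms(7) by (simp add: bij_betw_def image_image[of uminus dp_vec_val, symmetric])
      (simp add: image_image)
  have inj: "inj_on dp_vec_val SS" using assms(7) by (simp add: bij_betw_def)
  have sS: "?s a \<in> S" if "a \<in> SS" for a using that S_eq by blast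
  interpret dp_sites SS
  proof
    show "0 < a $ i" if "a \<in> SS" for a i using that assms(6) by (auto simp: dp_H_def)
    \<comment> \<open>Injectivity of \<open>dp_vec_val\<close> on \<open>SS\<close> yields distinct
      sites of \<open>S\<close>, to which general position applies.\<close>
    show "a = b" if ab: "a \<in> SS" "b \<in> SS" and v: "dp_val (a $ i) = dp_val (b $ i)" for a b i
    proof (rule ccontr)
      assume "a \<noteq> b"
      then have "?s a \<noteq> ?s b" using inj ab by (auto dest: inj_onD)
      then have "?s a $ i \<noteq> ?s b $ i"
        using assms(5) sS[OF ab(1)] sS[OF ab(2)] unfolding general_position_def by blast
      then show False using v by (simp add: dp_vec_val_def)
    qed
  qed
  \<comment> \<open>The coordinates of a site sum to 0, so \<open>d_tri\<close> is a positive
    multiple of \<open>trop_eval\<close> plus a term independent of the site.\<close>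
  have d: "d_tri w (?s a) = real CARD('n) * trop_eval w a - (\<Sum>i\<in>UNIV. w $ i)" if "a \<in> SS" for w a
  proof -
    have "?s a \<in> trop_H" using sS[OF that] assms(2) by blast
    then show ?thesis
      by (simp add: d_tri_def trop_H_def sum_subtractf trop_eval_def dp_vec_val_def sum_negf)
  qed
  have vr: "voronoi_region S (?s a) = trop_cell {a} \<inter> trop_H" if "a \<in> SS" for a
  proof -
    have "(\<forall>b\<in>S. d_tri w (?s a) \<le> d_tri w b) \<longleftrightarrow> (\<forall>b\<in>SS. trop_eval w a \<le> trop_eval w b)" for w
      unfolding S_eq[symmetric] using d that by simp
    then show ?thesis by (auto simp: voronoi_region_def trop_cell_def)
  qed
  have img: "val_image (\<Inter>a\<in>A. power_region SS a) = (\<Inter>a\<in>A. voronoi_region S (?s a))"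
    if A: "A \<subseteq> SS" "A \<noteq> {}" for A
  proof -
    have "(\<Inter>a\<in>A. voronoi_region S (?s a)) = (\<Inter>a\<in>A. trop_cell {a} \<inter> trop_H)"
      using vr A by (intro INF_cong) auto
    then show ?thesis using trop_cell_INT[OF A(2)] val_image_INT_power_region[OF A] by simp
  qed
  have "voronoi_diagram S = val_image ` power_diagram SS"
  proof (intro equalityI subsetI)
    fix F assume "F \<in> voronoi_diagram S"
    then obtain B where B: "B \<subseteq> ?s ` SS" "B \<noteq> {}" "F = (\<Inter>b\<in>B. voronoi_region S b)"
      by (auto simp: voronoi_diagram_def S_eq)
    then obtain A where A: "A \<subseteq> SS" "B = ?s ` A" by (meson subset_image_iff)
    then have "F = val_image (\<Inter>a\<in>A. power_region SS a)" using img[of A] B by simp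
    moreover have "A \<noteq> {}" using A B by blast
    ultimately show "F \<in> val_image ` power_diagram SS"
      unfolding power_diagram_def using A by blast
  next
    fix F assume "F \<in> val_image ` power_diagram SS"
    then obtain A where A: "A \<subseteq> SS" "A \<noteq> {}" "F = val_image (\<Inter>a\<in>A. power_region SS a)"
      by (auto simp: power_diagram_def)
    then have "F = (\<Inter>b\<in>?s ` A. voronoi_region S b)" using img[of A] by simp
    moreover have "?s ` A \<subseteq> S" "?s ` A \<noteq> {}" using A sS by auto
    ultimately show "F \<in> voronoi_diagram S" unfolding voronoi_diagram_def by blast
  qed
  moreover have refl: "F \<subseteq> G \<longleftrightarrow> val_image F \<subseteq> val_image G"
    if "F \<in> power_diagram SS" "G \<in> power_diagram SS" for F G
  proof
    show "val_image F \<subseteq> val_image G" if "F \<subseteq> G" using that by (auto simp: val_image_def)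
    show "F \<subseteq> G" if "val_image F \<subseteq> val_image G"
    proof -
      obtain A where A: "F = (\<Inter>a\<in>A. power_region SS a)" "A \<subseteq> SS" "A \<noteq> {}"
        using \<open>F \<in> power_diagram SS\<close> by (auto simp: power_diagram_def)
      obtain B where B: "G = (\<Inter>a\<in>B. power_region SS a)" "B \<subseteq> SS" "B \<noteq> {}"
        using \<open>G \<in> power_diagram SS\<close> by (auto simp: power_diagram_def)
      show ?thesis using val_image_reflects_subset[of A B] A B that by simp
    qed
  qed
  moreover have "inj_on val_image (power_diagram SS)"
  proof (rule inj_onI)
    fix F G assume FG: "F \<in> power_diagram SS" "G \<in> power_diagram SS" "val_image F = val_image G"
    then show "F = G" using refl[of F G] refl[of G F] by simp
  qed
  ultimately have "poset_iso val_image (power_diagram SS) (voronoi_diagram S)"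
    by (simp add: poset_iso_def bij_betw_def)
  moreover have "val_image (power_region SS a) = voronoi_region S (?s a)" if "a \<in> SS" for a
    using img[of "{a}"] that by simp
  ultimately show ?thesis using sS by blast
qed

end
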